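(* Let $X$ be a locally convex space such that the topology of $X$ is not weak and there is an $\ell_1$-sequence in $X$ with dense linear span. Then there exists a hereditarily hypercyclic operator $T\in L(X)$.
   Context: All vector spaces are over $\mathbb K$, which is either $\mathbb R$ or $\mathbb C$; all topological spaces are Hausdorff; topological vector spaces are non-trivial ($\neq\{0\}$). A locally convex space is a locally convex topological vector space. $\mathbb Z_+$ is the set of non-negative integers. $L(X)$ is the space of continuous linear operators from $X$ to $X$. The topology of a topological vector space $X$ is called weak if it is exactly the weakest topology making each $f\in Y$ continuous, for some linear space $Y$ of linear functionals on $X$ separating points of $X$. A sequence $\{x_n\}_{n\in\mathbb Z_+}$ in a locally convex space $X$ is an $\ell_1$-sequence if $x_n\to 0$ and the series $\sum_{n=0}^\infty a_nx_n$ converges in $X$ for each $a\in\ell_1$. An operator $T\in L(X)$ is hereditarily hypercyclic if for each infinite subset $A$ of $\mathbb Z_+$ there is $x\in X$ (possibly depending on $A$) such that $\{T^nx:n\in A\}$ is dense in $X$. *)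

theory Defs
  imports "HOL-Analysis.Analysis"
begin

text \<open>
  The library's \<^const>\<open>convex\<close> and \<^const>\<open>span\<close> are tied to the real scalar multiplication of
  a type class, so the scalar multiplication is an explicit parameter here. All notions are stated
  for scalars in a \<^class>\<open>real_normed_field\<close>, but are meant for \<^typ>\<open>real\<close> and \<^typ>\<open>complex\<close>.
\<close>

locale topological_vector_space = vector_space smul
  for smul :: "'k::real_normed_field \<Rightarrow> 'a::{topological_ab_group_add,t2_space} \<Rightarrow> 'a" +
  assumes continuous_scale: "continuous_on UNIV (\<lambda>(c, x). smul c x)"
    and nontrivial: "\<exists>x::'a. x \<noteq> 0"

definition convex_wrt ::
    "('k::real_normed_field \<Rightarrow> 'a::ab_group_add \<Rightarrow> 'a) \<Rightarrow> 'a set \<Rightarrow> bool" where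
  "convex_wrt smul C \<longleftrightarrow>
     (\<forall>x\<in>C. \<forall>y\<in>C. \<forall>u v :: real. 0 \<le> u \<longrightarrow> 0 \<le> v \<longrightarrow> u + v = 1 \<longrightarrow>
        smul (of_real u) x + smul (of_real v) y \<in> C)"

locale locally_convex_space = topological_vector_space smul
  for smul :: "'k::real_normed_field \<Rightarrow> 'a::{topological_ab_group_add,t2_space} \<Rightarrow> 'a" +
  assumes locally_convex:
    "open U \<Longrightarrow> 0 \<in> U \<Longrightarrow> \<exists>V. open V \<and> 0 \<in> V \<and> V \<subseteq> U \<and> convex_wrt smul V"

definition separating_functional_space ::
    "('k::real_normed_field \<Rightarrow> 'a::ab_group_add \<Rightarrow> 'a) \<Rightarrow> ('a \<Rightarrow> 'k) set \<Rightarrow> bool" where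
  "separating_functional_space smul Y \<longleftrightarrow>
     (\<forall>f\<in>Y. Vector_Spaces.linear smul (*) f) \<and>
     (\<lambda>x. 0) \<in> Y \<and>
     (\<forall>f\<in>Y. \<forall>g\<in>Y. (\<lambda>x. f x + g x) \<in> Y) \<and>
     (\<forall>c. \<forall>f\<in>Y. (\<lambda>x. c * f x) \<in> Y) \<and>
     (\<forall>x y. x \<noteq> y \<longrightarrow> (\<exists>f\<in>Y. f x \<noteq> f y))"

definition has_weak_topology ::
    "('k::real_normed_field \<Rightarrow> 'a::{ab_group_add,topological_space} \<Rightarrow> 'a) \<Rightarrow> bool" where
  "has_weak_topology smul \<longleftrightarrow>
     (\<exists>Y. separating_functional_space smul Y \<and>
        (\<forall>U::'a set. open U \<longleftrightarrow> generate_topology {f -` V | f V. f \<in> Y \<and> open V} U))"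

definition l1_sequence ::
    "('k::real_normed_field \<Rightarrow> 'a::{ab_group_add,topological_space} \<Rightarrow> 'a) \<Rightarrow>
     (nat \<Rightarrow> 'a) \<Rightarrow> bool" where
  "l1_sequence smul x \<longleftrightarrow>
     x \<longlonglongrightarrow> 0 \<and>
     (\<forall>a. summable (\<lambda>n. norm (a n)) \<longrightarrow> summable (\<lambda>n. smul (a n) (x n)))"

definition continuous_linear_operators ::
    "('k::real_normed_field \<Rightarrow> 'a::{ab_group_add,topological_space} \<Rightarrow> 'a) \<Rightarrow> ('a \<Rightarrow> 'a) set" where
  "continuous_linear_operators smul =
     {T. Vector_Spaces.linear smul smul T \<and> continuous_on UNIV T}"

definition hereditarily_hypercyclic :: "('a::topological_space \<Rightarrow> 'a) \<Rightarrow> bool" where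
  "hereditarily_hypercyclic T \<longleftrightarrow>
     (\<forall>A::nat set. infinite A \<longrightarrow> (\<exists>x. closure {(T ^^ n) x | n. n \<in> A} = UNIV))"

end

theory Submission
  imports Defs "HOL-Computational_Algebra.Polynomial"
begin

text \<open>
  Since the topology is not weak, some continuous seminorm \<open>p\<close> is not dominated by finitely many
  continuous functionals. By induction one finds vectors \<open>w\<^sub>n\<close> in the span of the
  \<open>\<ell>\<^sub>1\<close>-sequence, with dense span, and biorthogonal functionals \<open>f\<^sub>n\<close> dominated by arbitrarily small
  multiples of \<open>p\<close>. Then \<open>T v = v + (\<Sum>n. f\<^sub>n(v) (\<Sum>j<n. (n choose j) w\<^sub>j))\<close> converges, is continuous,
  and maps \<open>w\<^sub>n\<close> to \<open>\<Sum>j\<le>n. (n choose j) w\<^sub>j\<close>: identifying \<open>w\<^sub>n\<close> with the monomial \<open>z\<^sup>n\<close>,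
  \<open>T\<close> becomes the translation \<open>r(z) \<mapsto> r(z + 1)\<close> of polynomials. For polynomials \<open>a\<close>, \<open>b\<close> and large
  \<open>k\<close>, two-point Hermite interpolation at \<open>0\<close> and \<open>k\<close> provides a polynomial \<open>h\<close> such that \<open>h\<close> and
  \<open>(a + h)(z + k) - b(z)\<close> have only small coefficients. Hypercyclic vectors are then sums of series
  of such corrections; these converge since the image of the unit ball of \<open>\<ell>\<^sub>1\<close> spans a Banach
  space, so neither completeness nor metrizability of the space itself is needed.
\<close>

section \<open>Hahn--Banach functionals for seminorms\<close>

definition seminorm_wrt :: "('k::real_normed_field \<Rightarrow> 'a::ab_group_add \<Rightarrow> 'a) \<Rightarrow> ('a \<Rightarrow> real) \<Rightarrow> bool" where
  "seminorm_wrt smul p \<longleftrightarrow>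
     (\<forall>x y. p (x + y) \<le> p x + p y) \<and> (\<forall>c x. p (smul c x) = norm c * p x)"

definition sublinear_wrt :: "(real \<Rightarrow> 'a::ab_group_add \<Rightarrow> 'a) \<Rightarrow> ('a \<Rightarrow> real) \<Rightarrow> bool" where
  "sublinear_wrt smul p \<longleftrightarrow>
     (\<forall>x y. p (x + y) \<le> p x + p y) \<and> (\<forall>t x. 0 \<le> t \<longrightarrow> p (smul t x) = t * p x)"

section \<open>Sublinear functionals on real vector spaces\<close>

context
  fixes smul :: "real \<Rightarrow> 'a::ab_group_add \<Rightarrow> 'a"
  assumes vs: "vector_space smul"
begin

interpretation vector_space smul by (fact vs)

lemma sublinearD:
  assumes "sublinear_wrt smul p"
  shows "p (x + y) \<le> p x + p y" "0 \<le> t \<Longrightarrow> p (smul t x) = t * p x"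
    "p 0 = 0" "- p (- x) \<le> p x"
proof -
  show *: "p (x + y) \<le> p x + p y" "0 \<le> t \<Longrightarrow> p (smul t x) = t * p x" for x y t
    using assms by (auto simp: sublinear_wrt_def)
  show z: "p 0 = 0" using *(2)[of 0 0] by simp
  show "- p (- x) \<le> p x" using *(1)[of x "-x"] z by simp
qed

text \<open>A minimal sublinear functional is unchanged by sliding along any \<open>x0\<close>, hence is odd and linear.\<close>
lemma sublinear_slide:
  assumes p: "sublinear_wrt smul p"
  obtains q where "sublinear_wrt smul q" "\<And>x. q x \<le> p x" "q (- x0) \<le> - p x0"
proof -
  \<comment> \<open>The infimum runs over all slides by \<open>t \<ge> 0\<close>:
    \<open>t = 0\<close> gives \<open>q \<le> p\<close>, and \<open>t = 1\<close> at the point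
    \<open>- x0\<close> gives \<open>q (- x0) \<le> - p x0\<close> because
    \<open>p 0 = 0\<close>.\<close>
  define Q where "Q x = {p (x + smul t x0) - t * p x0 | t. 0 \<le> t}" for x
  define q where "q x = Inf (Q x)" for x
  \<comment> \<open>A lower bound independent of \<open>t\<close>, so that the infimum is a genuine
    one.\<close>
  have lower: "- p (- x) \<le> a" if a: "a \<in> Q x" for a x
  proof -
    obtain t where t: "0 \<le> t" "a = p (x + smul t x0) - t * p x0"
      using a by (auto simp: Q_def)
    have "t * p x0 = p ((x + smul t x0) + - x)" using sublinearD(2)[OF p t(1)] by simp
    also have "\<dots> \<le> p (x + smul t x0) + p (- x)" by (rule sublinearD(1)[OF p])
    finally show ?thesis using t by simp
  qed
  have bdd: "bdd_below (Q x)" for x by (rule bdd_belowI[OF lower])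
  have le: "q x \<le> p (x + smul t x0) - t * p x0" if "0 \<le> t" for x t
    unfolding q_def by (rule cInf_lower[OF _ bdd]) (use that in \<open>auto simp: Q_def\<close>)
  have ge: "a \<le> q x" if "\<And>t. 0 \<le> t \<Longrightarrow> a \<le> p (x + smul t x0) - t * p x0" for a x
    unfolding q_def by (rule cInf_greatest) (use that in \<open>auto simp: Q_def intro: exI[of _ 0]\<close>)
  have "q x \<le> p x" for x using le[of 0 x] by simp
  moreover have "q (- x0) \<le> - p x0" using le[of 1 "- x0"] sublinearD(3)[OF p] by simp
  moreover have "sublinear_wrt smul q"
    unfolding sublinear_wrt_def
  proof (intro conjI allI impI)
    fix x y
    \<comment> \<open>A slide by \<open>s\<close> for \<open>y\<close> and one by \<open>t\<close>
      for \<open>x\<close> combine into a slide by \<open>s + t\<close> for the sum; infima are then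
      taken over \<open>t\<close> and \<open>s\<close> in turn.\<close>
    have "q (x + y) - (p (y + smul s x0) - s * p x0) \<le> q x" if s: "0 \<le> s" for s
    proof (rule ge)
      fix t :: real assume t: "0 \<le> t"
      have "q (x + y) \<le> p ((x + y) + smul (s + t) x0) - (s + t) * p x0"
        using s t by (intro le) auto
      also have "p ((x + y) + smul (s + t) x0) = p ((x + smul t x0) + (y + smul s x0))"
        by (simp add: algebra_simps)
      also have "\<dots> \<le> p (x + smul t x0) + p (y + smul s x0)" by (rule sublinearD(1)[OF p])
      finally show "q (x + y) - (p (y + smul s x0) - s * p x0) \<le> p (x + smul t x0) - t * p x0"
        by (simp add: algebra_simps)
    qed
    then have "q (x + y) - q x \<le> q y"
      by (intro ge) (simp add: algebra_simps)
    then show "q (x + y) \<le> q x + q y" by simp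
  next
    \<comment> \<open>One inequality is enough: for \<open>inverse c\<close> and
      \<open>smul c x\<close> it becomes the converse one.\<close>
    have pos: "c * q x \<le> q (smul c x)" if c: "0 < c" for c x
    proof (rule ge)
      fix t :: real assume t: "0 \<le> t"
      have "c * q x \<le> c * (p (x + smul (t / c) x0) - t / c * p x0)"
        using c t by (intro mult_left_mono le) auto
      also have "\<dots> = p (smul c (x + smul (t / c) x0)) - t * p x0"
        using c sublinearD(2)[OF p, of c] by (simp add: right_diff_distrib)
      finally show "c * q x \<le> p (smul c x + smul t x0) - t * p x0"
        using c by (simp add: scale_right_distrib)
    qed
    fix c x assume c: "0 \<le> (c::real)"
    show "q (smul c x) = c * q x"
    proof (cases "c = 0")
      case True
      have "0 \<le> q 0" by (rule ge) (use sublinearD(2)[OF p] in simp)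
      moreover have "q 0 \<le> 0" using le[of 0 0] sublinearD(3)[OF p] by simp
      ultimately show ?thesis using True by simp
    next
      case False
      with c have "c > 0" by simp
      with pos[of c x] pos[of "inverse c" "smul c x"] show ?thesis
        by (simp add: field_simps)
    qed
  qed
  ultimately show thesis using that by blast
qed

text \<open>Zorn's lemma with the order reversed, so that maximal for \<open>P\<close> means
  pointwise minimal. A chain is bounded by its pointwise infimum, which is finite because every
  sublinear \<open>f \<le> p\<close> satisfies \<open>- p (- x) \<le> f x\<close>.\<close>

lemma minimal_sublinear:
  assumes p: "sublinear_wrt smul p"
  obtains m where "sublinear_wrt smul m" "\<And>x. m x \<le> p x"
    "\<And>q. sublinear_wrt smul q \<Longrightarrow> (\<And>x. q x \<le> m x) \<Longrightarrow> q = m"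
proof -
  define A where "A = {q. sublinear_wrt smul q \<and> (\<forall>x. q x \<le> p x)}"
  define P where "P f g \<longleftrightarrow> (\<forall>x. g x \<le> (f x :: real))" for f g :: "'a \<Rightarrow> real"
  have po: "partial_order_on A (relation_of P A)"
    by (rule partial_order_on_relation_ofI)
      (auto simp: P_def fun_eq_iff intro: order.trans antisym)
  have "\<exists>m\<in>A. \<forall>a\<in>A. P m a \<longrightarrow> a = m"
  proof (rule predicate_Zorn[OF po])
    fix C assume C: "C \<in> Chains (relation_of P A)"
    have CA: "C \<subseteq> A" using C by (auto simp: Chains_def relation_of_def)
    have tot: "(\<forall>x. f x \<le> g x) \<or> (\<forall>x. g x \<le> f x)" if "f \<in> C" "g \<in> C" for f g
      using C that by (auto simp: Chains_def relation_of_def P_def)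
    show "\<exists>u\<in>A. \<forall>a\<in>C. P a u"
    proof (cases "C = {}")
      case True
      then show ?thesis using p by (intro bexI[of _ p]) (auto simp: A_def)
    next
      case False
      define u where "u x = (INF f\<in>C. f x)" for x
      have sub: "sublinear_wrt smul f" "f x \<le> p x" if "f \<in> C" for f x
        using that CA by (auto simp: A_def)
      have "- p (- x) \<le> f x" if "f \<in> C" for f x
        using sublinearD(4)[OF sub(1)[OF that], of x] sub(2)[OF that, of "- x"] by linarith
      then have bdd: "bdd_below ((\<lambda>f. f x) ` C)" for x by (auto intro!: bdd_belowI)
      have le: "u x \<le> f x" if "f \<in> C" for f x
        unfolding u_def by (rule cINF_lower[OF bdd that])
      have ge: "a \<le> u x" if "\<And>f. f \<in> C \<Longrightarrow> a \<le> f x" for a x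
        unfolding u_def by (rule cINF_greatest[OF False that])
      obtain f0 where f0: "f0 \<in> C" using False by blast
      have "sublinear_wrt smul u"
        unfolding sublinear_wrt_def
      proof (intro conjI allI impI)
        fix x y
        \<comment> \<open>Members of a chain are comparable, so the smaller of \<open>f\<close> and
          \<open>g\<close> serves as \<open>h\<close> for both arguments.\<close>
        have "u (x + y) \<le> f x + g y" if fg: "f \<in> C" "g \<in> C" for f g
        proof -
          obtain h where h: "h \<in> C" "h x \<le> f x" "h y \<le> g y"
            using tot[OF fg] fg by auto
          have "u (x + y) \<le> h (x + y)" by (rule le[OF h(1)])
          also have "\<dots> \<le> h x + h y" by (rule sublinearD(1)[OF sub(1)[OF h(1)]])
          finally show ?thesis using h by simp
        qed
        then have 1: "u (x + y) - f x \<le> g y" if "f \<in> C" "g \<in> C" for f g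
          using that by (simp add: diff_le_eq add.commute)
        have "u (x + y) - f x \<le> u y" if "f \<in> C" for f
          by (rule ge) (rule 1[OF that])
        then have "u (x + y) - u y \<le> u x" by (intro ge) (simp add: algebra_simps)
        then show "u (x + y) \<le> u x + u y" by simp
      next
        have pos: "c * u x \<le> u (smul c x)" if c: "0 \<le> c" for c x
        proof (rule ge)
          fix f assume f: "f \<in> C"
          show "c * u x \<le> f (smul c x)"
            unfolding sublinearD(2)[OF sub(1)[OF f] c] by (rule mult_left_mono[OF le[OF f] c])
        qed
        fix c x assume c: "0 \<le> (c::real)"
        show "u (smul c x) = c * u x"
        proof (cases "c = 0")
          case True
          have "u 0 \<le> f0 0" by (rule le[OF f0])
          then have "u 0 \<le> 0" using sublinearD(3)[OF sub(1)[OF f0]] by simp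
          moreover have "0 \<le> u 0" by (rule ge) (simp add: sublinearD(3)[OF sub(1)])
          ultimately show ?thesis using True by simp
        next
          case False
          with c have "c > 0" by simp
          with pos[of c x] pos[of "inverse c" "smul c x"] show ?thesis
            by (simp add: field_simps)
        qed
      qed
      moreover have "u x \<le> p x" for x using le[OF f0] sub(2)[OF f0] order.trans by blast
      ultimately show ?thesis using le by (intro bexI[of _ u]) (auto simp: A_def P_def)
    qed
  qed
  then obtain m where m: "m \<in> A" "\<And>a. a \<in> A \<Longrightarrow> P m a \<Longrightarrow> a = m" by blast
  show thesis
  proof (rule that)
    show "sublinear_wrt smul m" and le: "m x \<le> p x" for x using m(1) by (auto simp: A_def)
    fix q assume "sublinear_wrt smul q" "\<And>x. q x \<le> m x"
    then show "q = m" using le by (intro m(2)) (auto simp: A_def P_def intro: order.trans)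
  qed
qed

text \<open>A first slide along \<open>x0\<close> forces \<open>p' (- x0) \<le> - p x0\<close>, and
  everything below \<open>p'\<close> inherits this. A minimal sublinear functional below
  \<open>p'\<close> equals each of its own slides, hence is odd, and oddness turns sublinearity into
  linearity.\<close>

theorem Hahn_Banach_sublinear:
  assumes p: "sublinear_wrt smul p"
  obtains f where "Vector_Spaces.linear smul (*) f" "\<And>x. f x \<le> p x" "f x0 = p x0"
proof -
  obtain p' where p': "sublinear_wrt smul p'" "\<And>x. p' x \<le> p x" "p' (- x0) \<le> - p x0"
    using sublinear_slide[OF p] by metis
  obtain m where m: "sublinear_wrt smul m" "\<And>x. m x \<le> p' x"
    and min: "\<And>q. sublinear_wrt smul q \<Longrightarrow> (\<And>x. q x \<le> m x) \<Longrightarrow> q = m"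
    using minimal_sublinear[OF p'(1)] by metis
  have neg: "m (- x) = - m x" for x
  proof -
    obtain q where q: "sublinear_wrt smul q" "\<And>y. q y \<le> m y" "q (- x) \<le> - m x"
      using sublinear_slide[OF m(1)] by metis
    then have "m (- x) \<le> - m x" using min by blast
    then show ?thesis using sublinearD(4)[OF m(1), of x] by simp
  qed
  have add: "m (x + y) = m x + m y" for x y
    using sublinearD(1)[OF m(1), of x y] sublinearD(1)[OF m(1), of "x + y" "- y"] neg[of y] by simp
  have scale: "m (smul c x) = c * m x" for c x
  proof (cases "0 \<le> c")
    case True
    then show ?thesis by (rule sublinearD(2)[OF m(1)])
  next
    case False
    then show ?thesis using neg[of "smul (- c) x"] sublinearD(2)[OF m(1), of "- c" x] by simp
  qed
  show thesis
  proof
    show "Vector_Spaces.linear smul (*) m"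
      unfolding Vector_Spaces.linear_iff using vs add scale
      by (auto simp: vector_space_over_itself.vector_space_axioms)
    show "m x \<le> p x" for x using m(2) p'(2) order.trans by blast
    moreover have "p x0 \<le> m x0" using m(2)[of "- x0"] p'(3) neg[of x0] by simp
    ultimately show "m x0 = p x0" by (simp add: antisym)
  qed
qed

end

text \<open>Hahn-Banach as a property of the scalar multiplication: the construction of the operator
  takes it as a hypothesis and is thus carried out once for both scalar fields.\<close>

definition norming_functionals :: "('k::real_normed_field \<Rightarrow> 'a::ab_group_add \<Rightarrow> 'a) \<Rightarrow> bool" where
  "norming_functionals smul \<longleftrightarrow>
     (\<forall>p x0. seminorm_wrt smul p \<longrightarrow>
        (\<exists>f. Vector_Spaces.linear smul (*) f \<and> (\<forall>x. norm (f x) \<le> p x) \<and> norm (f x0) = p x0))"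

section \<open>Norming functionals over the real and the complex numbers\<close>

lemma norming_functionals_real:
  fixes smul :: "real \<Rightarrow> 'a::ab_group_add \<Rightarrow> 'a"
  assumes vs: "vector_space smul"
  shows "norming_functionals smul"
  unfolding norming_functionals_def
proof (intro allI impI)
  fix p x0 assume p: "seminorm_wrt smul p"
  interpret vector_space smul by (fact vs)
  have "sublinear_wrt smul p" using p by (auto simp: sublinear_wrt_def seminorm_wrt_def)
  then obtain f where f: "Vector_Spaces.linear smul (*) f" "\<And>x. f x \<le> p x" "f x0 = p x0"
    using Hahn_Banach_sublinear[OF vs] by metis
  interpret f: Vector_Spaces.linear smul "(*)" f by (fact f(1))
  have p_neg: "p (- x) = p x" for x
    using p unfolding seminorm_wrt_def by (metis scale_minus_left scale_one norm_minus_cancel norm_one mult_1)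
  have "norm (f x) \<le> p x" for x
    using f(2)[of x] f(2)[of "- x"] by (simp add: p_neg f.neg abs_le_iff)
  moreover from this[of x0] have "norm (f x0) = p x0" using f(3) by simp
  ultimately show "\<exists>f. Vector_Spaces.linear smul (*) f \<and> (\<forall>x. norm (f x) \<le> p x) \<and> norm (f x0) = p x0"
    using f(1) by blast
qed

text \<open>The real Hahn-Banach theorem yields the real part \<open>g\<close>, and complex
  linearity dictates the imaginary part. The bound passes from \<open>g\<close> to the modulus of
  \<open>f\<close> because a unimodular factor rotates \<open>f x\<close> onto the nonnegative real
  axis.\<close>

lemma norming_functionals_complex:
  fixes smul :: "complex \<Rightarrow> 'a::ab_group_add \<Rightarrow> 'a"
  assumes vs: "vector_space smul"
  shows "norming_functionals smul"
  unfolding norming_functionals_def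
proof (intro allI impI)
  fix p x0 assume p: "seminorm_wrt smul p"
  interpret vector_space smul by (fact vs)
  define smulR where "smulR t x = smul (of_real t) x" for t x
  have vsR: "vector_space smulR"
    by unfold_locales (simp_all add: smulR_def scale_right_distrib scale_left_distrib)
  have "sublinear_wrt smulR p"
    using p by (auto simp: sublinear_wrt_def seminorm_wrt_def smulR_def)
  then obtain g where g: "Vector_Spaces.linear smulR (*) g" "\<And>x. g x \<le> p x" "g x0 = p x0"
    using Hahn_Banach_sublinear[OF vsR] by metis
  have g_add: "g (x + y) = g x + g y" and g_scale: "g (smul (of_real t) x) = t * g x" for x y t
    using g(1) by (auto simp: Vector_Spaces.linear_iff smulR_def)
  define f where "f x = Complex (g x) (- g (smul \<i> x))" for x
  have f_add: "f (x + y) = f x + f y" for x y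
    by (simp add: f_def g_add scale_right_distrib complex_eq_iff)
  have f_scale: "f (smul c x) = c * f x" for c x
  proof -
    have c: "smul c x = smul (of_real (Re c)) x + smul (of_real (Im c)) (smul \<i> x)" for x
      by (subst complex_eq[of c]) (simp add: scale_left_distrib mult.commute)
    have "smul \<i> (smul c x) = smul c (smul \<i> x)" by (simp add: mult.commute)
    then have "g (smul \<i> (smul c x)) = Re c * g (smul \<i> x) + Im c * g (smul \<i> (smul \<i> x))"
      by (simp only: c[of "smul \<i> x"] g_add g_scale)
    also have "g (smul \<i> (smul \<i> x)) = - g x"
      using g_scale[of "-1" x] by simp
    finally have "g (smul \<i> (smul c x)) = Re c * g (smul \<i> x) - Im c * g x" by simp
    moreover have "g (smul c x) = Re c * g x + Im c * g (smul \<i> x)"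
      by (simp only: c[of x] g_add g_scale)
    ultimately show ?thesis
      unfolding f_def by (simp add: complex_eq_iff)
  qed
  have le: "norm (f x) \<le> p x" for x
  proof (cases "f x = 0")
    case True
    have "p 0 = 0" using p unfolding seminorm_wrt_def by (metis scale_zero_left norm_zero mult_zero_left)
    moreover have "p (- x) = p x"
      using p unfolding seminorm_wrt_def by (metis scale_minus_left scale_one norm_minus_cancel norm_one mult_1)
    ultimately have "0 \<le> p x" using p unfolding seminorm_wrt_def
      by (smt (verit, best) add.right_inverse)
    then show ?thesis using True by simp
  next
    case False
    define c where "c = of_real (norm (f x)) / f x"
    have c: "norm c = 1" using False by (simp add: c_def norm_divide)
    have "f (smul c x) = of_real (norm (f x))" using False by (simp add: f_scale c_def)
    then have "norm (f x) = Re (f (smul c x))" by simp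
    also have "\<dots> = g (smul c x)" by (simp add: f_def)
    also have "\<dots> \<le> p (smul c x)" by (rule g(2))
    also have "\<dots> = p x" using p c by (simp add: seminorm_wrt_def)
    finally show ?thesis .
  qed
  have "p x0 = Re (f x0)" by (simp add: f_def g(3))
  also have "\<dots> \<le> norm (f x0)" by (rule complex_Re_le_cmod)
  finally have "norm (f x0) = p x0" using le[of x0] by simp
  moreover have "Vector_Spaces.linear smul (*) f"
    unfolding Vector_Spaces.linear_iff using vs f_add f_scale
    by (auto simp: vector_space_over_itself.vector_space_axioms)
  ultimately show "\<exists>f. Vector_Spaces.linear smul (*) f \<and> (\<forall>x. norm (f x) \<le> p x) \<and> norm (f x0) = p x0"
    using le by blast
qed

section \<open>Continuous seminorms\<close>

context
  fixes smul :: "'k::real_normed_field \<Rightarrow> 'a::ab_group_add \<Rightarrow> 'a" and p :: "'a \<Rightarrow> real"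
  assumes vs: "vector_space smul" and p: "seminorm_wrt smul p"
begin

interpretation vector_space smul by (fact vs)

lemma seminorm_wrtD:
  shows "p (x + y) \<le> p x + p y" "p (smul c x) = norm c * p x" "p 0 = 0" "p (- x) = p x"
    "0 \<le> p x" "p (x - y) \<le> p x + p y" "p (x - y) = p (y - x)"
proof -
  show add: "p (x + y) \<le> p x + p y" and scale: "p (smul c x) = norm c * p x" for x y c
    using p by (auto simp: seminorm_wrt_def)
  show z: "p 0 = 0" using scale[of 0 0] by simp
  show neg: "p (- x) = p x" for x using scale[of "-1" x] by simp
  show "0 \<le> p x" using add[of x "- x"] z neg by simp
  show "p (x - y) \<le> p x + p y" using add[of x "- y"] neg by simp
  show "p (x - y) = p (y - x)" using neg[of "x - y"] by simp
qed

lemma seminorm_wrt_sum: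
  shows "p (\<Sum>i\<in>I. x i) \<le> (\<Sum>i\<in>I. p (x i))"
proof (induction I rule: infinite_finite_induct)
  case (insert i I)
  then show ?case using seminorm_wrtD(1)[of "x i" "sum x I"] by simp
qed (simp_all add: seminorm_wrtD(3))

end

context locally_convex_space
begin

text \<open>Continuity at 0 gives continuity everywhere by the reverse triangle inequality. The
  filter \<open>nhds 0\<close> includes the point 0 itself, so the limit composes with arbitrary
  null families.\<close>

definition continuous_seminorm :: "('a \<Rightarrow> real) \<Rightarrow> bool" where
  "continuous_seminorm p \<longleftrightarrow> seminorm_wrt smul p \<and> (p \<longlongrightarrow> 0) (nhds 0)"

lemma csn_seminorm: "continuous_seminorm p \<Longrightarrow> seminorm_wrt smul p"
  by (simp add: continuous_seminorm_def)

lemmas csnD = seminorm_wrtD[OF vector_space_axioms csn_seminorm]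

lemma tendsto_scale:
  assumes "(f \<longlongrightarrow> c) F" "(g \<longlongrightarrow> x) F"
  shows "((\<lambda>z. smul (f z) (g z)) \<longlongrightarrow> smul c x) F"
proof -
  have "continuous (at (c, x)) (\<lambda>(c, x). smul c x)"
    using continuous_scale by (simp add: continuous_on_eq_continuous_at)
  then have "isCont (\<lambda>z. smul (fst z) (snd z)) (c, x)" by (simp add: case_prod_beta')
  from isCont_tendsto_compose[OF this tendsto_Pair[OF assms]] show ?thesis by simp
qed

text \<open>The gauge of the balanced core of a convex neighbourhood of \<open>0\<close>.\<close>
lemma continuous_seminorm_exists:
  assumes U: "open U" "0 \<in> U"
  obtains p where "continuous_seminorm p" "{x. p x < 1} \<subseteq> U"
proof -
  obtain V where V: "open V" "0 \<in> V" "V \<subseteq> U" "convex_wrt smul V"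
    using locally_convex[OF U] by blast
  define C where "C = {x. \<forall>c. norm c \<le> 1 \<longrightarrow> smul c x \<in> V}"
  \<comment> \<open>Joint continuity of the scalar multiplication at (0, 0) makes the core
    \<open>C\<close> a neighbourhood of 0: \<open>C\<close> contains \<open>e\<close> times every
    vector that satisfies \<open>Q\<close>.\<close>
  have "(fst \<longlongrightarrow> 0) (nhds (0 :: 'k, 0 :: 'a))" "(snd \<longlongrightarrow> 0) (nhds (0 :: 'k, 0 :: 'a))"
    by (auto simp: nhds_prod filterlim_fst filterlim_snd)
  from tendsto_scale[OF this]
  have "((\<lambda>z. smul (fst z) (snd z)) \<longlongrightarrow> 0) (nhds (0, 0))" by simp
  then have "\<forall>\<^sub>F z in nhds (0, 0). smul (fst z) (snd z) \<in> V"
    using V by (auto dest: topological_tendstoD)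
  then obtain P Q where P: "\<forall>\<^sub>F c in nhds 0. P c" and Q: "\<forall>\<^sub>F x in nhds 0. Q x"
    and PQ: "\<And>c x. P c \<Longrightarrow> Q x \<Longrightarrow> smul c x \<in> V"
    unfolding nhds_prod eventually_prod_filter by auto
  obtain d where d: "d > 0" "\<And>c. norm c < d \<Longrightarrow> P c"
    using P by (auto simp: eventually_nhds_metric)
  define e where "e = d / 2"
  have e: "e > 0" using d by (simp add: e_def)
  have QC: "smul (of_real e) x \<in> C" if "Q x" for x
  proof -
    have "smul c (smul (of_real e) x) \<in> V" if "norm c \<le> 1" for c
    proof -
      have "norm c * e \<le> 1 * e" using e that by (intro mult_right_mono) auto
      then have "norm (c * of_real e) < d" using e d by (simp add: norm_mult e_def)
      then have "smul (c * of_real e) x \<in> V" using d PQ \<open>Q x\<close> by blast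
      then show ?thesis by simp
    qed
    then show ?thesis by (simp add: C_def)
  qed
  have C_balanced: "smul c x \<in> C" if "x \<in> C" "norm c \<le> 1" for c x
  proof -
    have "smul b (smul c x) \<in> V" if "norm b \<le> 1" for b
    proof -
      have "norm (b * c) \<le> 1" using that \<open>norm c \<le> 1\<close> by (simp add: norm_mult mult_le_one)
      then show ?thesis using \<open>x \<in> C\<close> by (simp add: C_def)
    qed
    then show ?thesis by (simp add: C_def)
  qed
  have C_convex: "smul (of_real u) x + smul (of_real v) y \<in> C"
    if xy: "x \<in> C" "y \<in> C" and uv: "0 \<le> u" "0 \<le> v" "u + v = 1" for x y u v
  proof -
    have "smul c (smul (of_real u) x + smul (of_real v) y) \<in> V" if c: "norm c \<le> 1" for c
    proof -
      have "smul c x \<in> V" "smul c y \<in> V" using xy c by (auto simp: C_def)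
      then have "smul (of_real u) (smul c x) + smul (of_real v) (smul c y) \<in> V"
        using V(4) uv unfolding convex_wrt_def by blast
      then show ?thesis by (simp add: scale_right_distrib mult.commute[of c])
    qed
    then show ?thesis by (simp add: C_def)
  qed
  define S where "S x = {t::real. 0 < t \<and> smul (of_real (inverse t)) x \<in> C}" for x
  define p where "p x = Inf (S x)" for x
  have bdd: "bdd_below (S x)" for x by (rule bdd_belowI[of _ 0]) (auto simp: S_def)
  have S_up: "t \<in> S x" if s: "s \<in> S x" and st: "s \<le> t" for s t x
  proof -
    have "norm (of_real (s / t) :: 'k) \<le> 1" using s st by (simp add: S_def norm_divide)
    with s have "smul (of_real (s / t)) (smul (of_real (inverse s)) x) \<in> C"
      using C_balanced unfolding S_def by blast
    then show ?thesis using s st by (simp add: S_def field_simps)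
  qed
  \<comment> \<open>\<open>C\<close> is absorbing, since \<open>x / t\<close> tends to 0 as
    \<open>t\<close> grows and finally satisfies \<open>Q\<close>.\<close>
  have ne: "S x \<noteq> {}" for x
  proof -
    have "((\<lambda>t. smul (of_real (inverse t)) x) \<longlongrightarrow> smul (of_real 0) x) at_top"
      by (intro tendsto_scale tendsto_of_real tendsto_inverse_0_at_top filterlim_ident tendsto_const)
    then have "\<forall>\<^sub>F t in at_top. Q (smul (of_real (inverse t)) x) \<and> t > (0::real)"
      using Q by (intro eventually_conj eventually_gt_at_top) (simp add: filterlim_iff)
    then obtain t where t: "Q (smul (of_real (inverse t)) x)" "t > 0"
      by (auto simp: eventually_at_top_linorder)
    from QC[OF t(1)] have "t / e \<in> S x" using t e by (simp add: S_def field_simps)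
    then show ?thesis by blast
  qed
  have le: "p x \<le> t" if "t \<in> S x" for x t
    unfolding p_def by (rule cInf_lower[OF that bdd])
  have lt: "t \<in> S x" if "p x < t" for x t
    using that S_up unfolding p_def cInf_less_iff[OF ne bdd] by (meson less_imp_le)
  have nonneg: "0 \<le> p x" for x
    unfolding p_def by (rule cInf_greatest[OF ne]) (auto simp: S_def)
  have add: "p (x + y) \<le> p x + p y" for x y
  proof (rule field_le_epsilon)
    fix d :: real assume d: "0 < d"
    define s t where "s = p x + d / 2" and "t = p y + d / 2"
    have st: "s \<in> S x" "t \<in> S y" using d by (auto intro!: lt simp: s_def t_def)
    then have pos: "0 < s" "0 < t" and mem: "smul (of_real (inverse s)) x \<in> C" "smul (of_real (inverse t)) y \<in> C"
      by (auto simp: S_def)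
    \<comment> \<open>\<open>(x + y) / (s + t)\<close> is the convex combination of
      \<open>x / s\<close> and \<open>y / t\<close> with these weights.\<close>
    from C_convex[OF mem, of "s / (s + t)" "t / (s + t)"] pos
    have "s + t \<in> S (x + y)"
      by (simp add: S_def scale_right_distrib field_simps flip: add_divide_distrib)
    then show "p (x + y) \<le> p x + p y + d" using le by (fastforce simp: s_def t_def)
  qed
  have scale_le: "p (smul c x) \<le> norm c * p x" if c: "c \<noteq> 0" for c x
  proof (rule field_le_epsilon)
    fix d :: real assume d: "0 < d"
    define t where "t = p x + d / norm c"
    have "t \<in> S x" using d c by (auto intro!: lt simp: t_def)
    then have t: "0 < t" "smul (of_real (inverse t)) x \<in> C" by (auto simp: S_def)
    \<comment> \<open>The phase of \<open>c\<close> is absorbed by the balanced set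
      \<open>C\<close>; only its modulus changes the gauge.\<close>
    have "smul (c / of_real (norm c)) (smul (of_real (inverse t)) x) \<in> C"
      using c by (intro C_balanced t) (simp add: norm_divide)
    then have "norm c * t \<in> S (smul c x)" using t c
      by (simp add: S_def field_simps)
    then have "p (smul c x) \<le> norm c * t" by (rule le)
    also have "norm c * t = norm c * p x + d" using c by (simp add: t_def distrib_left)
    finally show "p (smul c x) \<le> norm c * p x + d" .
  qed
  have "0 \<in> C" using V by (simp add: C_def)
  then have "t \<in> S 0" if "t > 0" for t using that by (simp add: S_def)
  then have p0: "p 0 = 0" using nonneg[of 0] le[of _ 0] by (meson antisym dense_ge)
  have scale: "p (smul c x) = norm c * p x" for c x
  proof (cases "c = 0")
    case True
    then show ?thesis using p0 by simp
  next
    case False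
    have "norm c * p x = norm c * p (smul (inverse c) (smul c x))" using False by simp
    also have "\<dots> \<le> norm c * (norm (inverse c) * p (smul c x))"
      using False by (intro mult_left_mono scale_le) auto
    also have "\<dots> = p (smul c x)" using False by (simp add: norm_inverse)
    finally show ?thesis using scale_le[OF False, of x] by simp
  qed
  have "(p \<longlongrightarrow> 0) (nhds 0)"
  proof (rule tendstoI)
    fix r :: real assume r: "r > 0"
    \<comment> \<open>Chosen so that \<open>e * a\<close> is the inverse of \<open>r / 2\<close>;
      half of \<open>r\<close> makes the final inequality strict.\<close>
    define a where "a = 2 / (r * e)"
    have "((\<lambda>x. smul (of_real a) x) \<longlongrightarrow> smul (of_real a) 0) (nhds 0)"
      by (intro tendsto_scale tendsto_const filterlim_ident)
    then have "\<forall>\<^sub>F x in nhds 0. Q (smul (of_real a) x)"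
      using Q by (simp add: filterlim_iff)
    then show "\<forall>\<^sub>F x in nhds 0. dist (p x) 0 < r"
    proof eventually_elim
      case (elim x)
      from QC[OF this] have "r / 2 \<in> S x" using r e by (simp add: S_def a_def)
      from le[OF this] show ?case using r nonneg[of x] by simp
    qed
  qed
  then have "continuous_seminorm p"
    using add scale by (simp add: continuous_seminorm_def seminorm_wrt_def)
  moreover have "{x. p x < 1} \<subseteq> U"
  proof safe
    fix x assume "p x < 1"
    then have "1 \<in> S x" by (rule lt)
    then have "smul 1 x \<in> V" unfolding S_def C_def by (auto dest: spec[of _ 1])
    then show "x \<in> U" using V by auto
  qed
  ultimately show thesis by (rule that)
qed

section \<open>Limits, closures and continuity through continuous seminorms\<close>

lemma csn_tendsto:
  assumes "continuous_seminorm p" "(f \<longlongrightarrow> x) F"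
  shows "((\<lambda>z. p (f z - x)) \<longlongrightarrow> 0) F"
proof -
  have "((\<lambda>z. f z - x) \<longlongrightarrow> 0) F" using tendsto_diff[OF assms(2) tendsto_const[of x]] by simp
  then show ?thesis
    using assms(1) filterlim_compose[of p "nhds 0" "nhds 0" "\<lambda>z. f z - x" F]
    by (simp add: continuous_seminorm_def)
qed

lemma tendsto_csnI:
  assumes "\<And>p. continuous_seminorm p \<Longrightarrow> ((\<lambda>z. p (f z - x)) \<longlongrightarrow> 0) F"
  shows "(f \<longlongrightarrow> x) F"
proof (rule topological_tendstoI)
  fix S assume S: "open S" "x \<in> S"
  have "open ((\<lambda>y. y + x) -` S)" by (intro open_vimage S continuous_intros)
  moreover have "0 \<in> (\<lambda>y. y + x) -` S" using S by simp
  ultimately obtain p where p: "continuous_seminorm p" "{y. p y < 1} \<subseteq> (\<lambda>y. y + x) -` S"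
    by (rule continuous_seminorm_exists)
  have "\<forall>\<^sub>F z in F. p (f z - x) < 1" using assms[OF p(1)] by (rule order_tendstoD) simp
  then show "\<forall>\<^sub>F z in F. f z \<in> S" by eventually_elim (use p in auto)
qed

lemma open_csnE:
  assumes "open U" "x \<in> U"
  obtains p where "continuous_seminorm p" "\<And>y. p (y - x) < 1 \<Longrightarrow> y \<in> U"
proof -
  have "open ((\<lambda>y. y + x) -` U)" by (intro open_vimage assms continuous_intros)
  moreover have "0 \<in> (\<lambda>y. y + x) -` U" using assms by simp
  ultimately obtain p where p: "continuous_seminorm p" "{y. p y < 1} \<subseteq> (\<lambda>y. y + x) -` U"
    by (rule continuous_seminorm_exists)
  then show thesis by (intro that[of p]) auto
qed

lemma open_csn_ball:
  assumes p: "continuous_seminorm p"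
  shows "open {y. p (y - x) < r}"
proof -
  have "continuous_on UNIV p"
    unfolding continuous_on_eq_continuous_at[OF open_UNIV] isCont_def
  proof (intro ballI, rule Lim_null[THEN iffD2])
    fix a
    show "((\<lambda>z. p z - p a) \<longlongrightarrow> 0) (at a)"
    proof (rule tendsto_rabs_zero_cancel, rule real_tendsto_sandwich[OF _ _ tendsto_const])
      show "((\<lambda>z. p (z - a)) \<longlongrightarrow> 0) (at a)"
        by (intro csn_tendsto p tendsto_ident_at)
      show "\<forall>\<^sub>F z in at a. \<bar>p z - p a\<bar> \<le> p (z - a)"
      proof (intro always_eventually allI)
        fix z
        show "\<bar>p z - p a\<bar> \<le> p (z - a)"
          using csnD(1)[OF p, of "z - a" a] csnD(1)[OF p, of "a - z" z] csnD(7)[OF p, of a z] by simp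
      qed
    qed simp
  qed
  moreover have "continuous_on UNIV (\<lambda>y. y - x)"
    by (intro continuous_on_diff continuous_on_id continuous_on_const)
  ultimately have "continuous_on UNIV (\<lambda>y. p (y - x))"
    by (rule continuous_on_compose2) simp
  then show ?thesis by (rule open_Collect_less[OF _ continuous_on_const])
qed

text \<open>Balls of single continuous seminorms already form a neighbourhood base, so seminorms can
  be tested one at a time.\<close>

lemma closure_csn_iff:
  "x \<in> closure S \<longleftrightarrow> (\<forall>p. continuous_seminorm p \<longrightarrow> (\<forall>e>0. \<exists>y\<in>S. p (y - x) < e))"
proof safe
  fix p and e :: real assume x: "x \<in> closure S" and p: "continuous_seminorm p" "e > 0"
  have "x \<in> {y. p (y - x) < e}" using p by (simp add: csnD(3))
  then have "{y. p (y - x) < e} \<inter> S \<noteq> {}"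
    using x open_Int_closure_eq_empty[OF open_csn_ball[OF p(1), of x e], of S] by blast
  then show "\<exists>y\<in>S. p (y - x) < e" by auto
next
  assume *: "\<forall>p. continuous_seminorm p \<longrightarrow> (\<forall>e>0. \<exists>y\<in>S. p (y - x) < e)"
  show "x \<in> closure S"
  proof (rule ccontr)
    assume "x \<notin> closure S"
    then have "open (- closure S)" "x \<in> - closure S" by auto
    then obtain p where p: "continuous_seminorm p" "\<And>y. p (y - x) < 1 \<Longrightarrow> y \<in> - closure S"
      by (rule open_csnE) auto
    from *[rule_format, OF p(1) zero_less_one] obtain y where "y \<in> S" "p (y - x) < 1" by blast
    then show False using p(2)[of y] closure_subset[of S] by auto
  qed
qed

lemma continuous_on_linearI:
  assumes add: "\<And>x y. f (x - y) = f x - (f y :: 'a)"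
    and bdd: "\<And>q. continuous_seminorm q \<Longrightarrow> \<exists>p M. continuous_seminorm p \<and> (\<forall>x. q (f x) \<le> M * p x)"
  shows "continuous_on UNIV f"
  unfolding continuous_on_eq_continuous_at[OF open_UNIV] isCont_def
proof (intro ballI, rule tendsto_csnI)
  fix a q assume q: "continuous_seminorm q"
  obtain p M where p: "continuous_seminorm p" "\<And>x. q (f x) \<le> M * p x"
    using bdd[OF q] by blast
  show "((\<lambda>z. q (f z - f a)) \<longlongrightarrow> 0) (at a)"
  proof (rule real_tendsto_sandwich[OF _ _ tendsto_const])
    show "\<forall>\<^sub>F z in at a. 0 \<le> q (f z - f a)" by (simp add: csnD(5)[OF q])
    show "\<forall>\<^sub>F z in at a. q (f z - f a) \<le> M * p (z - a)" using p(2)[of "_ - a"] by (intro always_eventually allI) (simp add: add)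
    show "((\<lambda>z. M * p (z - a)) \<longlongrightarrow> 0) (at a)"
      by (intro tendsto_mult_right_zero csn_tendsto p tendsto_ident_at)
  qed
qed

lemma continuous_on_functionalI:
  fixes f :: "'a \<Rightarrow> 'k"
  assumes f: "Vector_Spaces.linear smul (*) f" and p: "continuous_seminorm p"
    and bdd: "\<And>x. norm (f x) \<le> M * p x"
  shows "continuous_on UNIV f"
  unfolding continuous_on_eq_continuous_at[OF open_UNIV] isCont_def
proof (intro ballI, rule Lim_null[THEN iffD2], rule tendsto_norm_zero_cancel,
    rule real_tendsto_sandwich[OF _ _ tendsto_const])
  fix a
  interpret f: Vector_Spaces.linear smul "(*)" f by (fact f)
  show "\<forall>\<^sub>F z in at a. 0 \<le> norm (f z - f a)" by simp
  show "\<forall>\<^sub>F z in at a. norm (f z - f a) \<le> M * p (z - a)"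
    using bdd[of "_ - a"] by (intro always_eventually allI) (simp add: f.diff)
  show "((\<lambda>z. M * p (z - a)) \<longlongrightarrow> 0) (at a)"
    by (intro tendsto_mult_right_zero csn_tendsto p tendsto_ident_at)
qed

text \<open>If every continuous seminorm were dominated by finitely many continuous functionals,
  the topology would be the weak topology induced by all of them.\<close>
lemma not_weak_seminorm:
  assumes nw: "\<not> has_weak_topology smul"
  obtains p where "continuous_seminorm p"
    "\<And>F. finite F \<Longrightarrow> (\<And>f. f \<in> F \<Longrightarrow> Vector_Spaces.linear smul (*) f \<and> continuous_on UNIV f) \<Longrightarrow>
       \<not> (\<exists>M. \<forall>x. p x \<le> M * (\<Sum>f\<in>F. norm (f x)))"
proof -
  define Y where "Y = {f. Vector_Spaces.linear smul (*) f \<and> continuous_on UNIV f}"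
  have "has_weak_topology smul"
    if *: "\<And>p. continuous_seminorm p \<Longrightarrow> \<exists>F\<subseteq>Y. finite F \<and> (\<exists>M. \<forall>x. p x \<le> M * (\<Sum>f\<in>F. norm (f x)))"
  proof -
    have lin: "Vector_Spaces.linear smul (*) f \<longleftrightarrow>
      (\<forall>x y. f (x + y) = f x + f y) \<and> (\<forall>c x. f (smul c x) = c * f x)" for f :: "'a \<Rightarrow> 'k"
      unfolding Vector_Spaces.linear_iff
      by (auto intro: vector_space_axioms vector_space_over_itself.vector_space_axioms)
    have diff: "f (x - y) = f x - f y" if "f \<in> Y" for f x y
    proof -
      interpret f: Vector_Spaces.linear smul "(*)" f using that by (simp add: Y_def)
      show ?thesis by (rule f.diff)
    qed
    have "separating_functional_space smul Y"
      unfolding separating_functional_space_def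
    proof (intro conjI allI ballI impI)
      fix x y :: 'a assume "x \<noteq> y"
      then obtain U where U: "open U" "y \<in> U" "x \<notin> U" using hausdorff[of x y] by blast
      obtain p where p: "continuous_seminorm p" "\<And>z. p (z - y) < 1 \<Longrightarrow> z \<in> U"
        using open_csnE[OF U(1,2)] by blast
      obtain F M where F: "F \<subseteq> Y" "finite F" "\<And>x. p x \<le> M * (\<Sum>f\<in>F. norm (f x))"
        using *[OF p(1)] by blast
      show "\<exists>f\<in>Y. f x \<noteq> f y"
      proof (rule ccontr)
        assume "\<not> ?thesis"
        then have "(\<Sum>f\<in>F. norm (f (x - y))) = 0"
          using F(1) by (intro sum.neutral ballI) (simp add: diff subset_iff)
        then have "p (x - y) < 1" using F(3)[of "x - y"] by simp
        then show False using p(2) U(3) by blast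
      qed
    qed (auto simp: Y_def lin distrib_left mult.left_commute
        intro: continuous_on_add continuous_on_mult_left)
    moreover have "open U \<longleftrightarrow> generate_topology {f -` V | f V. f \<in> Y \<and> open V} U"
      (is "_ \<longleftrightarrow> generate_topology ?B U") for U :: "'a set"
    proof
      assume "generate_topology ?B U"
      then show "open U"
      proof induction
        case (Basis s)
        then show ?case by (auto simp: Y_def intro!: open_vimage)
      qed auto
    next
      assume U: "open U"
      have "\<exists>W. generate_topology ?B W \<and> y \<in> W \<and> W \<subseteq> U" if y: "y \<in> U" for y
      proof -
        obtain p where p: "continuous_seminorm p" "\<And>z. p (z - y) < 1 \<Longrightarrow> z \<in> U"
          using open_csnE[OF U y] by blast
        obtain F M where F: "F \<subseteq> Y" "finite F" "\<And>x. p x \<le> M * (\<Sum>f\<in>F. norm (f x))"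
          using *[OF p(1)] by blast
        \<comment> \<open>If every functional in \<open>F\<close> is at most \<open>d\<close> on a
          vector, then \<open>\<bar>M\<bar>\<close> times the sum of their norms stays below 1; the
          added ones cover \<open>M = 0\<close> and empty \<open>F\<close>.\<close>
        define d where "d = 1 / ((\<bar>M\<bar> + 1) * (card F + 1))"
        have d: "d > 0" by (simp add: d_def)
        define W where "W = (\<Inter>f\<in>F. f -` ball (f y) d)"
        have "generate_topology ?B (\<Inter>f\<in>G. f -` ball (f y) d)" if "G \<subseteq> F" "finite G" for G
          using that(2,1)
        proof (induction G rule: finite_induct)
          case empty
          then show ?case by (simp add: generate_topology.UNIV)
        next
          case (insert g G)
          have "generate_topology ?B (g -` ball (g y) d)"
            using insert F(1) by (intro generate_topology.Basis) auto
          then show ?case using insert by (simp add: generate_topology.Int)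
        qed
        then have "generate_topology ?B W" using F(2) by (simp add: W_def)
        moreover have "y \<in> W" using d by (simp add: W_def)
        moreover have "z \<in> U" if z: "z \<in> W" for z
        proof (rule p(2))
          have "norm (f (z - y)) \<le> d" if "f \<in> F" for f
            using z that F(1) diff[of f z y] by (auto simp: W_def dist_norm norm_minus_commute subset_iff less_imp_le)
          then have "(\<Sum>f\<in>F. norm (f (z - y))) \<le> card F * d"
            using sum_bounded_above[of F "\<lambda>f. norm (f (z - y))" d] by simp
          then have "\<bar>M\<bar> * (\<Sum>f\<in>F. norm (f (z - y))) \<le> \<bar>M\<bar> * (card F * d)"
            by (intro mult_left_mono) auto
          moreover have "M * (\<Sum>f\<in>F. norm (f (z - y))) \<le> \<bar>M\<bar> * (\<Sum>f\<in>F. norm (f (z - y)))"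
            by (intro mult_right_mono sum_nonneg) auto
          moreover have "\<bar>M\<bar> * (card F * d) < (\<bar>M\<bar> + 1) * ((card F + 1) * d)"
            by (rule mult_strict_mono) (use d in auto)
          moreover have "(\<bar>M\<bar> + 1) * ((card F + 1) * d) = 1"
          proof -
            have "\<bar>M\<bar> + 1 \<noteq> 0" "real (card F) + 1 \<noteq> 0" by linarith+
            then show ?thesis by (simp add: d_def)
          qed
          ultimately show "p (z - y) < 1" using F(3)[of "z - y"] by linarith
        qed
        ultimately show ?thesis by blast
      qed
      then have "U = \<Union>{W. generate_topology ?B W \<and> W \<subseteq> U}" by blast
      moreover have "generate_topology ?B (\<Union>{W. generate_topology ?B W \<and> W \<subseteq> U})"
        by (rule generate_topology.UN) blast
      ultimately show "generate_topology ?B U" by simp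
    qed
    ultimately show ?thesis unfolding has_weak_topology_def by blast
  qed
  then obtain p where p: "continuous_seminorm p"
    "\<not> (\<exists>F\<subseteq>Y. finite F \<and> (\<exists>M. \<forall>x. p x \<le> M * (\<Sum>f\<in>F. norm (f x))))"
    using nw by blast
  show thesis
    by (rule that[OF p(1)]) (use p(2) in \<open>auto simp: Y_def subset_iff\<close>)
qed

end

section \<open>The disc spanned by an \<open>\<ell>\<^sub>1\<close>-sequence\<close>

text \<open>Completeness of l1, in the form that absolutely convergent series converge:
  \<open>c n\<close> is the n-th vector, and the coordinatewise sum has norm at most the sum of the
  norms. Only finitely many coordinates at a time are interchanged with the sum over
  \<open>n\<close>.\<close>

lemma l1_double_series:
  fixes c :: "nat \<Rightarrow> nat \<Rightarrow> 'k::banach"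
  assumes c: "\<And>n. summable (\<lambda>i. norm (c n i))" "\<And>n. (\<Sum>i. norm (c n i)) \<le> g n"
    and g: "summable g"
  shows "summable (\<lambda>n. c n i)" "summable (\<lambda>i. norm (\<Sum>n. c n i))"
    "(\<Sum>i. norm (\<Sum>n. c n i)) \<le> suminf g"
proof -
  have le: "norm (c n i) \<le> g n" for n i
    using sum_le_suminf[OF c(1)[of n], of "{i}"] c(2)[of n] by simp
  have sm: "summable (\<lambda>n. norm (c n i))" for i
    by (rule summable_comparison_test'[OF g, of 0]) (simp add: le)
  show sc: "summable (\<lambda>n. c n i)" for i by (rule summable_norm_cancel[OF sm])
  have partial: "(\<Sum>i<N. norm (\<Sum>n. c n i)) \<le> suminf g" for N
  proof -
    have "(\<Sum>i<N. norm (\<Sum>n. c n i)) \<le> (\<Sum>i<N. \<Sum>n. norm (c n i))"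
      by (intro sum_mono summable_norm sm)
    also have "\<dots> = (\<Sum>n. \<Sum>i<N. norm (c n i))"
      by (rule suminf_sum[symmetric]) (rule sm)
    also have "\<dots> \<le> suminf g"
    proof (rule suminf_le[OF _ _ g])
      show "(\<Sum>i<N. norm (c n i)) \<le> g n" for n
        using sum_le_suminf[OF c(1)[of n], of "{..<N}"] c(2)[of n] by simp
      show "summable (\<lambda>n. \<Sum>i<N. norm (c n i))" by (rule summable_sum) (rule sm)
    qed
    finally show ?thesis .
  qed
  show s: "summable (\<lambda>i. norm (\<Sum>n. c n i))"
    by (rule summableI_nonneg_bounded[of _ "suminf g"]) (auto intro: partial)
  show "(\<Sum>i. norm (\<Sum>n. c n i)) \<le> suminf g"
    by (rule suminf_le_const[OF s partial])
qed

locale l1_disc = locally_convex_space smul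
  for smul :: "'k::{real_normed_field,banach} \<Rightarrow> 'a::{topological_ab_group_add,t2_space} \<Rightarrow> 'a" +
  fixes x :: "nat \<Rightarrow> 'a"
  assumes l1: "l1_sequence smul x"
begin

definition synth :: "(nat \<Rightarrow> 'k) \<Rightarrow> 'a" where
  "synth a = (\<Sum>n. smul (a n) (x n))"

text \<open>A bound \<open>t\<close> on the quotient norm that l1 induces on the image of
  \<open>synth\<close>, witnessed by a representing sequence. As a relation it also makes sense for
  vectors outside this image, which satisfy no bound.\<close>

definition in_disc :: "'a \<Rightarrow> real \<Rightarrow> bool" where
  "in_disc z t \<longleftrightarrow> (\<exists>a. summable (\<lambda>n. norm (a n)) \<and> (\<Sum>n. norm (a n)) \<le> t \<and> z = synth a)"

lemma synth_sums:
  assumes "summable (\<lambda>n. norm (a n))"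
  shows "(\<lambda>n. smul (a n) (x n)) sums synth a"
  using l1 assms unfolding l1_sequence_def synth_def by (blast intro: summable_sums)

lemma summable_norm_add:
  fixes a b :: "nat \<Rightarrow> 'k"
  assumes "summable (\<lambda>n. norm (a n))" "summable (\<lambda>n. norm (b n))"
  shows "summable (\<lambda>n. norm (a n + b n))"
  by (rule summable_comparison_test'[OF summable_add[OF assms], of 0]) (simp add: norm_triangle_ineq)

lemma synth_add:
  assumes "summable (\<lambda>n. norm (a n))" "summable (\<lambda>n. norm (b n))"
  shows "synth (\<lambda>n. a n + b n) = synth a + synth b"
proof -
  have "(\<lambda>n. smul (a n + b n) (x n)) sums (synth a + synth b)"
    using sums_add[OF synth_sums[OF assms(1)] synth_sums[OF assms(2)]]
    by (simp add: scale_left_distrib)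
  then show ?thesis by (rule sums_unique2[OF synth_sums[OF summable_norm_add[OF assms]]])
qed

lemma synth_scale:
  assumes "summable (\<lambda>n. norm (a n))"
  shows "synth (\<lambda>n. c * a n) = smul c (synth a)"
proof -
  have "(\<lambda>N. smul c (\<Sum>n<N. smul (a n) (x n))) \<longlonglongrightarrow> smul c (synth a)"
    using synth_sums[OF assms] unfolding sums_def by (intro tendsto_scale tendsto_const)
  then have "(\<lambda>n. smul (c * a n) (x n)) sums smul c (synth a)"
    unfolding sums_def by (simp add: scale_sum_right)
  moreover have "summable (\<lambda>n. norm (c * a n))"
    using summable_mult[OF assms, of "norm c"] by (simp add: norm_mult)
  ultimately show ?thesis by (rule sums_unique2[OF synth_sums, rotated])
qed

lemma in_disc_mono: "in_disc z s \<Longrightarrow> s \<le> t \<Longrightarrow> in_disc z t"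
  unfolding in_disc_def by (blast intro: order.trans)

lemma in_disc_nonneg: "in_disc z t \<Longrightarrow> 0 \<le> t"
  unfolding in_disc_def by (meson order.trans suminf_nonneg norm_ge_zero)

lemma in_disc_0: "in_disc 0 0"
  unfolding in_disc_def by (rule exI[of _ "\<lambda>_. 0"]) (simp add: synth_def)

lemma in_disc_add:
  assumes "in_disc y s" "in_disc z t"
  shows "in_disc (y + z) (s + t)"
proof -
  obtain a b where a: "summable (\<lambda>n. norm (a n))" "(\<Sum>n. norm (a n)) \<le> s" "y = synth a"
    and b: "summable (\<lambda>n. norm (b n))" "(\<Sum>n. norm (b n)) \<le> t" "z = synth b"
    using assms unfolding in_disc_def by blast
  have "(\<Sum>n. norm (a n + b n)) \<le> (\<Sum>n. norm (a n) + norm (b n))"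
    by (intro suminf_le summable_norm_add summable_add a b norm_triangle_ineq)
  also have "\<dots> \<le> s + t" using a b by (simp flip: suminf_add)
  finally show ?thesis
    unfolding in_disc_def using synth_add[OF a(1) b(1)] summable_norm_add[OF a(1) b(1)] a(3) b(3)
    by (intro exI[of _ "\<lambda>n. a n + b n"]) simp
qed

lemma in_disc_scale:
  assumes "in_disc z t"
  shows "in_disc (smul c z) (norm c * t)"
proof -
  obtain a where a: "summable (\<lambda>n. norm (a n))" "(\<Sum>n. norm (a n)) \<le> t" "z = synth a"
    using assms unfolding in_disc_def by blast
  have "summable (\<lambda>n. norm (c * a n))"
    using summable_mult[OF a(1), of "norm c"] by (simp add: norm_mult)
  moreover have "(\<Sum>n. norm (c * a n)) \<le> norm c * t"
    using suminf_mult[OF a(1), of "norm c"] mult_left_mono[OF a(2) norm_ge_zero[of c]]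
    by (simp add: norm_mult)
  ultimately show ?thesis
    unfolding in_disc_def by (intro exI[of _ "\<lambda>n. c * a n"]) (simp add: synth_scale[OF a(1)] a(3))
qed

lemma in_disc_sum:
  assumes "\<And>i. i \<in> I \<Longrightarrow> in_disc (z i) (t i)"
  shows "in_disc (\<Sum>i\<in>I. z i) (\<Sum>i\<in>I. t i)"
  using assms
  by (induction I rule: infinite_finite_induct) (auto intro: in_disc_add in_disc_0)

lemma in_disc_generator: "in_disc (x n) 1"
proof -
  define a :: "nat \<Rightarrow> 'k" where "a = (\<lambda>i. if i = n then 1 else 0)"
  have na: "(\<lambda>i. norm (a i)) = (\<lambda>i. if i = n then 1 else 0)" by (auto simp: a_def)
  have "(\<lambda>i. smul (a i) (x i)) = (\<lambda>i. if i = n then x i else 0)" by (auto simp: a_def)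
  then have "synth a = x n"
    unfolding synth_def using sums_unique[OF sums_single[of n x]] by simp
  moreover have "(\<lambda>i. norm (a i)) sums 1"
    unfolding na using sums_single[of n "\<lambda>_. 1::real"] by simp
  ultimately show ?thesis
    unfolding in_disc_def by (intro exI[of _ a]) (auto simp: sums_iff)
qed

lemma in_disc_span:
  assumes "z \<in> span (range x)"
  shows "\<exists>t. in_disc z t"
  using assms
proof (induction rule: span_induct_alt)
  case base
  then show ?case using in_disc_0 by blast
next
  case (step c y z)
  then show ?case using in_disc_add in_disc_scale in_disc_generator by blast
qed

text \<open>The null sequence \<open>x\<close> is bounded for \<open>q\<close>, so partial sums of a
  representing series are bounded by the l1 norm of its coefficients, and the bound survives in the
  limit. Estimates in the disc norm therefore carry over to every continuous seminorm.\<close>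

lemma csn_in_disc:
  assumes q: "continuous_seminorm q"
  obtains M where "0 < M" "\<And>z t. in_disc z t \<Longrightarrow> q z \<le> M * t"
proof -
  have "(\<lambda>n. q (x n)) \<longlonglongrightarrow> 0"
    using csn_tendsto[OF q, of x 0] l1 by (simp add: l1_sequence_def)
  then have "Bseq (\<lambda>n. q (x n))" by (meson convergentI convergent_imp_Bseq)
  then obtain M where M: "0 < M" "\<And>n. norm (q (x n)) \<le> M" by (auto elim: BseqE)
  show thesis
  proof (rule that[OF M(1)])
    fix z t assume "in_disc z t"
    then obtain a where a: "summable (\<lambda>n. norm (a n))" "(\<Sum>n. norm (a n)) \<le> t" "z = synth a"
      unfolding in_disc_def by blast
    define S where "S N = (\<Sum>n<N. smul (a n) (x n))" for N
    have "S \<longlonglongrightarrow> z" using synth_sums[OF a(1)] a(3) by (simp add: sums_def S_def[abs_def])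
    from csn_tendsto[OF q this] have lim: "(\<lambda>N. q (S N - z) + M * t) \<longlonglongrightarrow> 0 + M * t"
      by (intro tendsto_add tendsto_const)
    have "q z \<le> q (S N - z) + M * t" for N
    proof -
      have "q (S N) \<le> (\<Sum>n<N. q (smul (a n) (x n)))"
        unfolding S_def by (rule seminorm_wrt_sum[OF vector_space_axioms csn_seminorm[OF q]])
      also have "\<dots> \<le> (\<Sum>n<N. norm (a n) * M)"
        using M(2) by (intro sum_mono) (simp add: csnD(2)[OF q] mult_left_mono abs_le_iff)
      also have "\<dots> = M * (\<Sum>n<N. norm (a n))" by (simp add: sum_distrib_left mult.commute)
      also have "\<dots> \<le> M * t"
        using M(1) sum_le_suminf[OF a(1), of "{..<N}"] a(2) by (intro mult_left_mono) auto
      finally show ?thesis using csnD(6)[OF q, of "S N" "S N - z"] by simp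
    qed
    then show "q z \<le> M * t" using LIMSEQ_le_const[OF lim] by auto
  qed
qed

text \<open>The image of l1 is complete in its quotient norm: representing sequences of the terms
  are added coordinatewise in l1. The remainder estimates are kept because the hypercyclic vector is
  controlled through them.\<close>

lemma in_disc_series:
  assumes u: "\<And>n. in_disc (u n) (g n)" and g: "summable g"
  obtains z where "u sums z" "in_disc z (suminf g)"
    "\<And>N. in_disc (z - (\<Sum>n<N. u n)) (\<Sum>n. g (n + N))"
proof -
  from u have "\<forall>n. \<exists>a. summable (\<lambda>i. norm (a i)) \<and> (\<Sum>i. norm (a i)) \<le> g n \<and> u n = synth a"
    by (simp add: in_disc_def)
  then obtain c where c: "\<And>n. summable (\<lambda>i. norm (c n i))" "\<And>n. (\<Sum>i. norm (c n i)) \<le> g n"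
    and uc: "\<And>n. u n = synth (c n)" by metis
  \<comment> \<open>\<open>b N\<close> represents the remainder of the series from index
    \<open>N\<close> on; \<open>b 0\<close> represents its sum.\<close>
  define b where "b N i = (\<Sum>n. c (n + N) i)" for N i
  have shift: "\<And>n. summable (\<lambda>i. norm (c (n + N) i))" "\<And>n. (\<Sum>i. norm (c (n + N) i)) \<le> g (n + N)"
    "summable (\<lambda>n. g (n + N))" for N
    using c g by (auto simp: summable_iff_shift)
  have b: "summable (\<lambda>i. norm (b N i))" "(\<Sum>i. norm (b N i)) \<le> (\<Sum>n. g (n + N))" for N
    unfolding b_def using l1_double_series[OF shift] by auto
  have b_Suc: "b N i = c N i + b (Suc N) i" for N i
    unfolding b_def using suminf_split_head[OF l1_double_series(1)[OF shift, of N i]] by simp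
  have split: "synth (b 0) = (\<Sum>n<N. u n) + synth (b N)" for N
  proof (induction N)
    case (Suc N)
    have "synth (b N) = synth (\<lambda>i. c N i + b (Suc N) i)" by (rule arg_cong[of _ _ synth], rule ext) (rule b_Suc)
    also have "\<dots> = u N + synth (b (Suc N))" using synth_add[OF c(1) b(1)] by (simp add: uc)
    finally show ?case using Suc by simp
  qed simp
  have disc: "in_disc (synth (b 0) - (\<Sum>n<N. u n)) (\<Sum>n. g (n + N))" for N
    using split[of N] b[of N] unfolding in_disc_def by (intro exI[of _ "b N"]) simp
  have "u sums synth (b 0)"
    unfolding sums_def
  proof (rule tendsto_csnI)
    fix q assume q: "continuous_seminorm q"
    obtain M where M: "0 < M" "\<And>z t. in_disc z t \<Longrightarrow> q z \<le> M * t" using csn_in_disc[OF q] by blast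
    show "(\<lambda>N. q ((\<Sum>n<N. u n) - synth (b 0))) \<longlonglongrightarrow> 0"
    proof (rule real_tendsto_sandwich[OF _ _ tendsto_const])
      show "\<forall>\<^sub>F N in sequentially. 0 \<le> q ((\<Sum>n<N. u n) - synth (b 0))"
        by (simp add: csnD(5)[OF q])
      show "\<forall>\<^sub>F N in sequentially. q ((\<Sum>n<N. u n) - synth (b 0)) \<le> M * (\<Sum>n. g (n + N))"
        using M(2)[OF disc] by (subst csnD(7)[OF q]) simp
      show "(\<lambda>N. M * (\<Sum>n. g (n + N))) \<longlonglongrightarrow> 0"
        by (intro tendsto_mult_right_zero suminf_exist_split2 g)
    qed
  qed
  then show thesis using disc disc[of 0] by (intro that) auto
qed

end

section \<open>A small biorthogonal system\<close>

context l1_disc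
begin

text \<open>Only finitely many coordinates are involved at each stage, so a vector can be corrected to
  be annihilated by the previous functionals, and a functional to annihilate the previous vectors.
  Scaling the functional down and the vector up makes the functional as small as desired.\<close>
lemma biorthogonal_step:
  fixes n m :: nat and f :: "nat \<Rightarrow> 'a \<Rightarrow> 'k" and w :: "nat \<Rightarrow> 'a" and \<delta> \<epsilon> :: real
  assumes p: "continuous_seminorm p"
    and big: "\<And>F. finite F \<Longrightarrow> (\<And>f. f \<in> F \<Longrightarrow> Vector_Spaces.linear smul (*) f \<and> continuous_on UNIV f) \<Longrightarrow>
       \<not> (\<exists>M. \<forall>x. p x \<le> M * (\<Sum>f\<in>F. norm (f x)))"
    and norming: "norming_functionals smul"
    and dense: "closure (span (range x)) = UNIV"
    and f: "\<And>j. j < n \<Longrightarrow> Vector_Spaces.linear smul (*) (f j)" "\<And>j v. j < n \<Longrightarrow> norm (f j v) \<le> p v"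
    and fw: "\<And>i j. i < n \<Longrightarrow> j < n \<Longrightarrow> f i (w j) = (if i = j then 1 else 0)"
    and w: "\<And>j. j < n \<Longrightarrow> w j \<in> span (range x)"
    and pos: "0 < \<delta>" "0 < \<epsilon>"
  obtains h w' y where "Vector_Spaces.linear smul (*) h" "\<And>v. norm (h v) \<le> \<delta> * p v" "h w' = 1"
    "\<And>j. j < n \<Longrightarrow> h (w j) = 0" "\<And>j. j < n \<Longrightarrow> f j w' = 0"
    "w' \<in> span (range x)" "y \<in> span (insert w' (w ` {..<n}))" "in_disc (y - x m) \<epsilon>"
proof -
  have f_add: "f j (a + b) = f j a + f j b" and f_scale: "f j (smul c a) = c * f j a"
    and f_diff: "f j (a - b) = f j a - f j b" and f_sum: "f j (\<Sum>i\<in>I. g i) = (\<Sum>i\<in>I. f j (g i))"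
    if "j < n" for j a b c and g :: "nat \<Rightarrow> 'a" and I
  proof -
    interpret fj: Vector_Spaces.linear smul "(*)" "f j" by (rule f(1)[OF that])
    show "f j (a + b) = f j a + f j b" "f j (smul c a) = c * f j a"
      "f j (a - b) = f j a - f j b" "f j (\<Sum>i\<in>I. g i) = (\<Sum>i\<in>I. f j (g i))"
      by (fact fj.add fj.scale fj.diff fj.sum)+
  qed
  \<comment> \<open>The projection onto the common kernel of the functionals \<open>f j\<close>,
    \<open>j < n\<close>, along the span of the vectors \<open>w j\<close>.\<close>
  define \<pi> where "\<pi> v = v - (\<Sum>j<n. smul (f j v) (w j))" for v
  have \<pi>_add: "\<pi> (a + b) = \<pi> a + \<pi> b" for a b
    by (simp add: \<pi>_def f_add scale_left_distrib sum.distrib)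
  have \<pi>_scale: "\<pi> (smul c a) = smul c (\<pi> a)" for c a
    by (simp add: \<pi>_def f_scale scale_right_diff_distrib scale_sum_right)
  have f\<pi>: "f i (\<pi> v) = 0" if i: "i < n" for i v
  proof -
    have "(\<Sum>j<n. f j v * f i (w j)) = (\<Sum>j<n. if i = j then f i v else 0)"
      using i by (intro sum.cong) (auto simp: fw)
    also have "\<dots> = f i v" using i by simp
    finally show ?thesis unfolding \<pi>_def f_diff[OF i] f_sum[OF i] f_scale[OF i] by simp
  qed
  \<comment> \<open>Bounds \<open>\<pi>\<close> with respect to \<open>p\<close>, because
    \<open>norm (f j v) \<le> p v\<close>; the same constant bounds \<open>h1\<close> later.\<close>
  define C where "C = 1 + (\<Sum>j<n. p (w j))"
  have p\<pi>: "p (\<pi> v) \<le> C * p v" for v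
  proof -
    have "p (\<pi> v) \<le> p v + p (\<Sum>j<n. smul (f j v) (w j))"
      unfolding \<pi>_def by (rule csnD(6)[OF p])
    also have "p (\<Sum>j<n. smul (f j v) (w j)) \<le> (\<Sum>j<n. p (smul (f j v) (w j)))"
      by (rule seminorm_wrt_sum[OF vector_space_axioms csn_seminorm[OF p]])
    also have "\<dots> \<le> (\<Sum>j<n. p v * p (w j))"
      unfolding csnD(2)[OF p] by (intro sum_mono mult_right_mono csnD(5)[OF p] f(2)) auto
    finally show ?thesis by (simp add: C_def algebra_simps sum_distrib_left)
  qed
  have C: "1 \<le> C" unfolding C_def by (simp add: sum_nonneg csnD(5)[OF p])
  \<comment> \<open>Otherwise \<open>p\<close> composed with \<open>\<pi>\<close> vanishes on a
    dense subspace and, by the bound \<open>C\<close>, everywhere. Then \<open>p\<close> would be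
    dominated by the finitely many functionals \<open>f j\<close>, which \<open>big\<close>
    excludes.\<close>
  have "\<exists>k. p (\<pi> (x k)) \<noteq> 0"
  proof (rule ccontr)
    assume "\<not> ?thesis"
    then have x0: "p (\<pi> (x k)) = 0" for k by blast
    have span0: "p (\<pi> v) = 0" if "v \<in> span (range x)" for v
      using that
    proof (induction rule: span_induct_alt)
      case base
      show ?case using \<pi>_scale[of 0 0] csnD(3)[OF p] by simp
    next
      case (step c y z)
      then obtain k where "y = x k" by blast
      then have "p (\<pi> (smul c y + z)) \<le> 0"
        using csnD(1)[OF p, of "smul c (\<pi> y)" "\<pi> z"] step x0[of k]
        by (simp add: \<pi>_add \<pi>_scale csnD(2)[OF p])
      then show ?case using csnD(5)[OF p, of "\<pi> (smul c y + z)"] by simp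
    qed
    have \<pi>0: "p (\<pi> v) = 0" for v
    proof (rule antisym[OF field_le_epsilon csnD(5)[OF p]])
      fix e :: real assume e: "0 < e"
      have "v \<in> closure (span (range x))" using dense by simp
      then have "\<exists>y\<in>span (range x). p (y - v) < e / C"
        unfolding closure_csn_iff using p e C by simp
      then obtain y where y: "y \<in> span (range x)" "p (y - v) < e / C" by blast
      have "p (\<pi> v) \<le> p (\<pi> (v - y)) + p (\<pi> y)"
        using csnD(1)[OF p, of "\<pi> (v - y)" "\<pi> y"] by (simp flip: \<pi>_add)
      also have "\<dots> \<le> C * p (v - y)" using span0[OF y(1)] p\<pi>[of "v - y"] by simp
      also have "\<dots> \<le> e" using y(2) C by (simp add: csnD(7)[OF p, of v y] field_simps)
      finally show "p (\<pi> v) \<le> 0 + e" by simp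
    qed
    have "p v \<le> (\<Sum>j<n. p (w j)) * (\<Sum>g\<in>f ` {..<n}. norm (g v))" for v
    proof -
      have "p v \<le> p (\<pi> v) + p (\<Sum>j<n. smul (f j v) (w j))"
        using csnD(1)[OF p, of "\<pi> v" "\<Sum>j<n. smul (f j v) (w j)"] by (simp add: \<pi>_def)
      also have "\<dots> \<le> (\<Sum>j<n. p (smul (f j v) (w j)))"
        using seminorm_wrt_sum[OF vector_space_axioms csn_seminorm[OF p]] \<pi>0 by simp
      also have "\<dots> \<le> (\<Sum>j<n. p (w j) * (\<Sum>g\<in>f ` {..<n}. norm (g v)))"
        unfolding csnD(2)[OF p] mult.commute[of "p _"]
        by (intro sum_mono mult_right_mono csnD(5)[OF p] member_le_sum) auto
      finally show ?thesis by (simp add: sum_distrib_right)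
    qed
    moreover have "continuous_on UNIV (f j)" if "j < n" for j
      by (rule continuous_on_functionalI[OF f(1) p, of j 1]) (use that f(2) in auto)
    ultimately show False using big[of "f ` {..<n}"] f(1) by auto
  qed
  then obtain k where k: "p (\<pi> (x k)) \<noteq> 0" ..
  \<comment> \<open>If \<open>x m\<close> itself has \<open>p (\<pi> (x m)) = 0\<close>, a small
    multiple of the good generator \<open>x k\<close> is added to it.\<close>
  obtain y where y: "in_disc (y - x m) \<epsilon>" "p (\<pi> y) \<noteq> 0" "y \<in> span (range x)"
  proof (cases "p (\<pi> (x m)) = 0")
    case False
    then show ?thesis using in_disc_mono[OF in_disc_0, of \<epsilon>] pos
      by (intro that[of "x m"]) (auto intro: span_base)
  next
    case True
    show ?thesis
    proof (rule that[of "x m + smul (of_real \<epsilon>) (x k)"])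
      show "in_disc (x m + smul (of_real \<epsilon>) (x k) - x m) \<epsilon>"
        using in_disc_scale[OF in_disc_generator[of k], of "of_real \<epsilon>"] pos by simp
      have "\<epsilon> * p (\<pi> (x k)) = p (smul (of_real \<epsilon>) (\<pi> (x k)))" using pos by (simp add: csnD(2)[OF p])
      also have "\<dots> \<le> p (\<pi> (x m) + smul (of_real \<epsilon>) (\<pi> (x k))) + p (\<pi> (x m))"
        using csnD(6)[OF p, of "\<pi> (x m) + smul (of_real \<epsilon>) (\<pi> (x k))" "\<pi> (x m)"] by simp
      finally show "p (\<pi> (x m + smul (of_real \<epsilon>) (x k))) \<noteq> 0"
        using True k mult_pos_pos[OF pos(2), of "p (\<pi> (x k))"] csnD(5)[OF p, of "\<pi> (x k)"]
        unfolding \<pi>_add \<pi>_scale by linarith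
      show "x m + smul (of_real \<epsilon>) (x k) \<in> span (range x)"
        by (intro span_add span_scale span_base) auto
    qed
  qed
  obtain h0 where h0: "Vector_Spaces.linear smul (*) h0" "\<And>v. norm (h0 v) \<le> p v" "norm (h0 (\<pi> y)) = p (\<pi> y)"
    using norming csn_seminorm[OF p] unfolding norming_functionals_def by blast
  interpret h0: Vector_Spaces.linear smul "(*)" h0 by (fact h0(1))
  \<comment> \<open>The correction makes the functional vanish on every \<open>w j\<close>. On
    \<open>\<pi> y\<close> it changes nothing, since all \<open>f j\<close> vanish there, so the
    value stays nonzero.\<close>
  define h1 where "h1 v = h0 v - (\<Sum>j<n. h0 (w j) * f j v)" for v
  have h1_add: "h1 (a + b) = h1 a + h1 b" for a b
    by (simp add: h1_def f_add h0.add algebra_simps sum.distrib)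
  have h1_scale: "h1 (smul c a) = c * h1 a" for c a
    by (simp add: h1_def f_scale h0.scale algebra_simps sum_distrib_left)
  have h1_bound: "norm (h1 v) \<le> C * p v" for v
  proof -
    have "norm (h1 v) \<le> norm (h0 v) + (\<Sum>j<n. norm (h0 (w j) * f j v))"
      unfolding h1_def by (intro order.trans[OF norm_triangle_ineq4] add_left_mono norm_sum)
    also have "\<dots> \<le> p v + (\<Sum>j<n. p (w j) * p v)"
      unfolding norm_mult by (intro add_mono h0(2) sum_mono mult_mono f(2) csnD(5)[OF p]) auto
    finally show ?thesis by (simp add: C_def distrib_right sum_distrib_right)
  qed
  have h1_w: "h1 (w j) = 0" if j: "j < n" for j
  proof -
    have "(\<Sum>i<n. h0 (w i) * f i (w j)) = (\<Sum>i<n. if i = j then h0 (w j) else 0)"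
      using j by (intro sum.cong) (auto simp: fw)
    then show ?thesis using j by (simp add: h1_def)
  qed
  define a where "a = h1 (\<pi> y)"
  have "a = h0 (\<pi> y)" by (simp add: a_def h1_def f\<pi>)
  then have a: "a \<noteq> 0" using h0(3) y(2) by auto
  \<comment> \<open>\<open>h1\<close> is bounded by \<open>C * p\<close>, so the factor
    \<open>\<delta> / C\<close> brings the functional below \<open>\<delta> * p\<close>;
    \<open>w'\<close> is multiplied by the reciprocal of the resulting value.\<close>
  define d where "d = (of_real (\<delta> / C) :: 'k)"
  have d: "d \<noteq> 0" "norm d = \<delta> / C" using pos C by (auto simp: d_def norm_divide)
  define h where "h v = d * h1 v" for v
  define w' where "w' = smul (inverse (d * a)) (\<pi> y)"
  have \<pi>_y: "\<pi> y = smul (d * a) w'" using a d by (simp add: w'_def del: inverse_mult_distrib)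
  show thesis
  proof (rule that[of h w' y])
    show "Vector_Spaces.linear smul (*) h"
      unfolding Vector_Spaces.linear_iff
      by (auto simp: h_def h1_add h1_scale distrib_left
          intro: vector_space_axioms vector_space_over_itself.vector_space_axioms)
    show "norm (h v) \<le> \<delta> * p v" for v
    proof -
      have "norm (h v) \<le> \<delta> / C * (C * p v)"
        unfolding h_def norm_mult d(2) using pos C by (intro mult_left_mono h1_bound) auto
      then show ?thesis using C by simp
    qed
    show "h w' = 1" using a d by (simp add: h_def w'_def h1_scale a_def[symmetric] field_simps)
    show "h (w j) = 0" if "j < n" for j using h1_w[OF that] by (simp add: h_def)
    show "f j w' = 0" if "j < n" for j using that by (simp add: w'_def f_scale f\<pi>)
    have "\<pi> y \<in> span (range x)"
      unfolding \<pi>_def by (intro span_diff span_sum span_scale y w) auto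
    then show "w' \<in> span (range x)" unfolding w'_def by (rule span_scale)
    \<comment> \<open>This keeps \<open>y\<close> in the span of the vectors chosen so far, from
      which density of their span will follow.\<close>
    have "y = smul (d * a) w' + (\<Sum>j<n. smul (f j y) (w j))"
      by (simp add: \<pi>_y[symmetric] \<pi>_def)
    also have "\<dots> \<in> span (insert w' (w ` {..<n}))"
      by (intro span_add span_sum span_scale span_base) auto
    finally show "y \<in> span (insert w' (w ` {..<n}))" .
  qed (fact y)
qed

text \<open>Stage \<open>n\<close> applies \<open>biorthogonal_step\<close> to the index
  \<open>m\<close> that is the first component of \<open>prod_decode n\<close>, so each
  \<open>x m\<close> is approached at infinitely many stages with errors tending to 0. The sum
  bounded by \<open>t n\<close> contains only earlier vectors, so \<open>f n\<close> can be chosen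
  small relative to \<open>t n\<close>.\<close>

lemma biorthogonal_system:
  assumes nw: "\<not> has_weak_topology smul" and norming: "norming_functionals smul"
    and dense: "closure (span (range x)) = UNIV"
  obtains p w f t where "continuous_seminorm p"
    "\<And>n. Vector_Spaces.linear smul (*) (f n)" "\<And>n v. norm (f n v) * t n \<le> (1/2) ^ n * p v"
    "\<And>i j. f i (w j) = (if i = j then 1 else 0)"
    "\<And>n. in_disc (\<Sum>j<n. smul (of_nat (n choose j)) (w j)) (t n)"
    "\<And>n. w n \<in> span (range x)" "closure (span (range w)) = UNIV"
proof -
  obtain p where p: "continuous_seminorm p"
    "\<And>F. finite F \<Longrightarrow> (\<And>f. f \<in> F \<Longrightarrow> Vector_Spaces.linear smul (*) f \<and> continuous_on UNIV f) \<Longrightarrow>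
       \<not> (\<exists>M. \<forall>x. p x \<le> M * (\<Sum>f\<in>F. norm (f x)))"
    using not_weak_seminorm[OF nw] by blast
  define u where "u F n = (\<Sum>j<n. smul (of_nat (n choose j)) (fst (F j)))"
    for F :: "nat \<Rightarrow> 'a \<times> ('a \<Rightarrow> 'k)" and n
  \<comment> \<open>A stage is a pair of a vector and a functional. The factor \<open>1 + t\<close>
    yields two bounds at once: domination by \<open>p\<close>, required by the next step, and
    smallness against \<open>t\<close>.\<close>
  define R where "R F n r \<longleftrightarrow>
      Vector_Spaces.linear smul (*) (snd r) \<and>
      (\<exists>t. in_disc (u F n) t \<and> (\<forall>v. norm (snd r v) * (1 + t) \<le> (1/2) ^ n * p v)) \<and>
      snd r (fst r) = 1 \<and> (\<forall>j<n. snd r (fst (F j)) = 0 \<and> snd (F j) (fst r) = 0) \<and>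
      fst r \<in> span (range x) \<and>
      (\<exists>y\<in>span (insert (fst r) ((\<lambda>j. fst (F j)) ` {..<n})).
        in_disc (y - x (fst (prod_decode n))) ((1/2) ^ n))"
    for F :: "nat \<Rightarrow> 'a \<times> ('a \<Rightarrow> 'k)" and n and r :: "'a \<times> ('a \<Rightarrow> 'k)"
  have small: "norm (snd r v) \<le> p v" if "R F n r" for F n r v
  proof -
    obtain t where t: "in_disc (u F n) t" "norm (snd r v) * (1 + t) \<le> (1/2) ^ n * p v"
      using \<open>R F n r\<close> unfolding R_def by blast
    have "norm (snd r v) * 1 \<le> norm (snd r v) * (1 + t)"
      using in_disc_nonneg[OF t(1)] by (intro mult_left_mono) auto
    also have "\<dots> \<le> 1 * p v"
      using t(2) by (rule order.trans) (intro mult_right_mono csnD(5)[OF p(1)] power_le_one, auto)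
    finally show ?thesis by simp
  qed
  have "\<exists>F. \<forall>n. R F n (F n)"
  \<comment> \<open>\<open>R F n\<close> reads \<open>F\<close> only below \<open>n\<close>, as
    course-of-values recursion demands.\<close>
  proof (rule dependent_wellorder_choice)
    fix r F G and n :: nat assume FG: "\<And>j. j < n \<Longrightarrow> F j = (G j :: 'a \<times> ('a \<Rightarrow> 'k))"
    have "u F n = u G n" unfolding u_def using FG by (intro sum.cong) auto
    moreover have "(\<lambda>j. fst (F j)) ` {..<n} = (\<lambda>j. fst (G j)) ` {..<n}"
      using FG by (intro image_cong) auto
    ultimately show "R F n r = R G n r" unfolding R_def using FG by simp
  next
    fix n F assume F: "\<And>j. j < n \<Longrightarrow> R F j (F j)"
    have Fj: "Vector_Spaces.linear smul (*) (snd (F j))" "snd (F j) (fst (F j)) = 1"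
      "fst (F j) \<in> span (range x)" if "j < n" for j
      using F[OF that] unfolding R_def by blast+
    have off: "snd (F j) (fst (F i)) = 0 \<and> snd (F i) (fst (F j)) = 0" if "i < j" "j < n" for i j
      using F[OF that(2)] that(1) unfolding R_def by blast
    have biorth: "snd (F i) (fst (F j)) = (if i = j then 1 else 0)" if "i < n" "j < n" for i j
      using off[of i j] off[of j i] Fj(2) that by (cases i j rule: linorder_cases) auto
    have "u F n \<in> span (range x)" unfolding u_def by (intro span_sum span_scale Fj(3)) auto
    then obtain t where t: "in_disc (u F n) t" using in_disc_span by blast
    define \<delta> where "\<delta> = (1/2) ^ n / (1 + t)"
    have t0: "0 \<le> t" by (rule in_disc_nonneg[OF t])
    then have \<delta>: "0 < \<delta>" "0 < (1/2::real) ^ n" by (simp_all add: \<delta>_def)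
    obtain h w' y where h: "Vector_Spaces.linear smul (*) h" "\<And>v. norm (h v) \<le> \<delta> * p v" "h w' = 1"
      "\<And>j. j < n \<Longrightarrow> h (fst (F j)) = 0" "\<And>j. j < n \<Longrightarrow> snd (F j) w' = 0" "w' \<in> span (range x)"
      "y \<in> span (insert w' ((\<lambda>j. fst (F j)) ` {..<n}))"
      "in_disc (y - x (fst (prod_decode n))) ((1/2) ^ n)"
      by (rule biorthogonal_step[where p = p and n = n and f = "\<lambda>j. snd (F j)" and w = "\<lambda>j. fst (F j)"
          and \<delta> = \<delta> and \<epsilon> = "(1/2) ^ n" and m = "fst (prod_decode n)",
          OF p(1) _ norming dense _ _ _ _ \<delta>])
        ((rule p(2) Fj small[OF F] biorth; blast) | blast)+
    have "norm (h v) * (1 + t) \<le> (1/2) ^ n * p v" for v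
      using mult_right_mono[OF h(2)[of v], of "1 + t"] t0 by (simp add: \<delta>_def)
    then have "R F n (w', h)" unfolding R_def using h t by auto
    then show "\<exists>r. R F n r" ..
  qed
  then obtain F where F: "\<And>n. R F n (F n)" by blast
  define w f where "w n = fst (F n)" and "f n = snd (F n)" for n
  have wf: "Vector_Spaces.linear smul (*) (f n)" "f n (w n) = 1" "w n \<in> span (range x)"
    "\<exists>t. in_disc (u F n) t \<and> (\<forall>v. norm (f n v) * (1 + t) \<le> (1/2) ^ n * p v)"
    "\<exists>y\<in>span (insert (w n) ((\<lambda>j. fst (F j)) ` {..<n})).
        in_disc (y - x (fst (prod_decode n))) ((1/2) ^ n)" for n
    using F[of n] unfolding R_def w_def f_def by blast+
  have off: "f j (w i) = 0 \<and> f i (w j) = 0" if "i < j" for i j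
    using F[of j] that unfolding R_def w_def f_def by blast
  obtain t where t: "\<And>n. in_disc (u F n) (t n)" "\<And>n v. norm (f n v) * (1 + t n) \<le> (1/2) ^ n * p v"
    using wf(4) by metis
  show thesis
  proof (rule that[of p f t w])
    show "continuous_seminorm p" by (fact p)
    show "Vector_Spaces.linear smul (*) (f n)" "w n \<in> span (range x)" for n by (fact wf)+
    show "norm (f n v) * t n \<le> (1/2) ^ n * p v" for n v
      using t(2)[of n v] norm_ge_zero[of "f n v"] unfolding distrib_left by linarith
    show "f i (w j) = (if i = j then 1 else 0)" for i j
      using off[of i j] off[of j i] wf(2) by (cases i j rule: linorder_cases) auto
    show "in_disc (\<Sum>j<n. smul (of_nat (n choose j)) (w j)) (t n)" for n
      using t(1)[of n] by (simp add: u_def w_def)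
    have gen: "x m \<in> closure (span (range w))" for m
      unfolding closure_csn_iff
    proof (intro allI impI)
      fix q and e :: real assume q: "continuous_seminorm q" and e: "0 < e"
      obtain M where M: "0 < M" "\<And>z t. in_disc z t \<Longrightarrow> q z \<le> M * t" using csn_in_disc[OF q] by blast
      have "(\<lambda>N. M * (1/2) ^ N) \<longlonglongrightarrow> 0"
        by (intro tendsto_mult_right_zero LIMSEQ_realpow_zero) auto
      then have "\<forall>\<^sub>F N in sequentially. M * (1/2) ^ N < e"
        using e by (intro order_tendstoD) auto
      then obtain N0 where N0: "\<And>N. N0 \<le> N \<Longrightarrow> M * (1/2) ^ N < e"
        by (auto simp: eventually_sequentially)
      \<comment> \<open>A stage that treats \<open>m\<close> and is not earlier than
        \<open>N0\<close>.\<close>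
      define N where "N = prod_encode (m, N0)"
      obtain y where y: "y \<in> span (insert (w N) ((\<lambda>j. fst (F j)) ` {..<N}))"
        "in_disc (y - x m) ((1/2) ^ N)"
        using wf(5)[of N] by (auto simp: N_def)
      have "y \<in> span (range w)" using y(1) span_mono[of "insert (w N) ((\<lambda>j. fst (F j)) ` {..<N})" "range w"]
        by (auto simp: w_def)
      moreover have "q (y - x m) < e"
        using M(2)[OF y(2)] N0[of N] le_prod_encode_2[of N0 m] unfolding N_def by linarith
      ultimately show "\<exists>y\<in>span (range w). q (y - x m) < e" by blast
    qed
    have lin: "v \<in> closure (span (range w))" if "v \<in> span (range x)" for v
      using that
    proof (induction rule: span_induct_alt)
      case base
      show ?case using closure_subset span_zero by blast
    next
      case (step c y z)
      then obtain m where m: "y = x m" by blast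
      show ?case
        unfolding closure_csn_iff
      proof (intro allI impI)
        fix q and e :: real assume q: "continuous_seminorm q" and e: "0 < e"
        define e' where "e' = e / (2 * (norm c + 1))"
        have e': "0 < e'" "norm c * e' \<le> e / 2"
          using e by (auto simp: e'_def field_simps add_pos_nonneg)
        obtain a where a: "a \<in> span (range w)" "q (a - y) < e'"
          using gen[of m] q e'(1) unfolding closure_csn_iff m by blast
        obtain b where b: "b \<in> span (range w)" "q (b - z) < e / 2"
          using step.IH q e unfolding closure_csn_iff by (metis half_gt_zero)
        have "q ((smul c a + b) - (smul c y + z)) \<le> q (smul c (a - y)) + q (b - z)"
          using csnD(1)[OF q, of "smul c (a - y)" "b - z"]
          by (simp add: scale_right_diff_distrib algebra_simps)
        also have "q (smul c (a - y)) \<le> norm c * e'"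
          using a(2) by (simp add: csnD(2)[OF q] mult_left_mono)
        finally have "q ((smul c a + b) - (smul c y + z)) < e" using b(2) e'(2) by linarith
        then show "\<exists>y'\<in>span (range w). q (y' - (smul c y + z)) < e"
          using a(1) b(1) span_add span_scale by blast
      qed
    qed
    have "span (range x) \<subseteq> closure (span (range w))" using lin by blast
    from closure_minimal[OF this closed_closure] show "closure (span (range w)) = UNIV"
      using dense by auto
  qed
qed

end

section \<open>Mixing of the translation on polynomials\<close>

lemma bezout_power_right:
  fixes a b :: "'a::comm_ring_1"
  assumes "u * a + v * b = 1"
  shows "\<exists>u v. u * a + v * b ^ n = 1"
proof (induction n)
  case 0
  show ?case by (rule exI[of _ 0], rule exI[of _ 1]) simp
next
  case (Suc n)
  then obtain u' v' where "u' * a + v' * b ^ n = 1" by blast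
  then have "(u' * a + v' * b ^ n) * (u * a + v * b) = 1" using assms by simp
  then have "(u' * (u * a + v * b) + v' * b ^ n * u) * a + (v' * v) * b ^ Suc n = 1"
    by (simp add: algebra_simps)
  then show ?case by blast
qed

text \<open>Raise first one and then the other element to its power, each time multiplying with the
  given identity. For \<open>z\<close> and \<open>1 - z\<close> this supplies the Hermite
  interpolation polynomials.\<close>

lemma bezout_power:
  fixes a b :: "'a::comm_ring_1"
  assumes "a + b = 1"
  shows "\<exists>u v. u * a ^ n + v * b ^ n = 1"
proof -
  obtain u v where "u * a + v * b ^ n = 1"
    using bezout_power_right[of 1 a 1 b n] assms by auto
  then have "v * b ^ n + u * a = 1" by (simp add: add.commute)
  from bezout_power_right[OF this, of n] show ?thesis
    by (metis add.commute)
qed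

text \<open>A weighted l1 norm of the coefficients. With \<open>\<beta> i\<close> a disc bound for
  \<open>w i\<close>, it bounds the vector that corresponds to the polynomial.\<close>

definition wnorm :: "(nat \<Rightarrow> real) \<Rightarrow> 'k::real_normed_field poly \<Rightarrow> real" where
  "wnorm \<beta> r = (\<Sum>i\<le>degree r. norm (coeff r i) * \<beta> i)"

lemma wnorm_altdef:
  assumes "degree r \<le> n"
  shows "wnorm \<beta> r = (\<Sum>i\<le>n. norm (coeff r i) * \<beta> i)"
  unfolding wnorm_def
  by (rule sum.mono_neutral_left) (use assms in \<open>auto simp: not_le coeff_eq_0\<close>)

lemma wnorm_0 [simp]: "wnorm \<beta> 0 = 0"
  by (simp add: wnorm_def)

lemma wnorm_minus [simp]: "wnorm \<beta> (- r) = wnorm \<beta> r"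
  by (simp add: wnorm_def)

lemma wnorm_smult: "wnorm \<beta> (smult c r) = norm c * wnorm \<beta> r"
  by (simp add: wnorm_altdef[of _ "degree r"] sum_distrib_left norm_mult mult.assoc)

lemma pcompose_power: "pcompose (p ^ n) r = pcompose p r ^ n" for p :: "'a::comm_semiring_1 poly"
  by (induction n) (simp_all add: pcompose_mult pcompose_1)

lemma coeff_pcompose_dilation:
  fixes W :: "'k::field poly"
  shows "coeff (pcompose W [:0, c:]) i = coeff W i * c ^ i"
proof -
  have "pcompose W [:0, c:] = pcompose (\<Sum>i\<le>degree W. monom (coeff W i) i) [:0, c:]"
    by (simp add: poly_as_sum_of_monoms)
  also have "\<dots> = (\<Sum>i\<le>degree W. monom (coeff W i * c ^ i) i)"
  proof -
    have "pcompose (monom (coeff W i) i) [:0, c:] = monom (coeff W i * c ^ i) i" for i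
    proof -
      have "[:0, c:] ^ i = smult (c ^ i) ([:0, 1:] ^ i)"
        using smult_power[of c "[:0, 1:]" i] by simp
      then show ?thesis
        by (simp add: monom_altdef pcompose_smult pcompose_power pcompose_pCons)
    qed
    then show ?thesis by (simp add: pcompose_sum)
  qed
  finally show ?thesis
    by (auto simp: coeff_sum coeff_eq_0 not_le sum.delta)
qed

section \<open>Estimates for the weighted norm under dilations and translations\<close>

context
  fixes \<beta> :: "nat \<Rightarrow> real"
  assumes \<beta>: "\<And>i. 0 \<le> \<beta> i"
begin

lemma wnorm_nonneg:
  shows "0 \<le> wnorm \<beta> r"
  unfolding wnorm_def by (intro sum_nonneg mult_nonneg_nonneg norm_ge_zero \<beta>)

lemma wnorm_add:
  shows "wnorm \<beta> (r + s) \<le> wnorm \<beta> r + wnorm \<beta> s"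
proof -
  let ?n = "max (degree r) (degree s)"
  have "wnorm \<beta> (r + s) = (\<Sum>i\<le>?n. norm (coeff r i + coeff s i) * \<beta> i)"
    by (simp add: wnorm_altdef[OF degree_add_le_max])
  also have "\<dots> \<le> (\<Sum>i\<le>?n. (norm (coeff r i) + norm (coeff s i)) * \<beta> i)"
    by (intro sum_mono mult_right_mono norm_triangle_ineq \<beta>)
  also have "\<dots> = wnorm \<beta> r + wnorm \<beta> s"
    by (simp add: wnorm_altdef[of _ ?n] distrib_right sum.distrib)
  finally show ?thesis .
qed

lemma wnorm_sum:
  fixes r :: "'i \<Rightarrow> 'k::real_normed_field poly"
  shows "wnorm \<beta> (\<Sum>i\<in>I. r i) \<le> (\<Sum>i\<in>I. wnorm \<beta> (r i))"
proof (induction I rule: infinite_finite_induct)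
  case (insert x F)
  then show ?case using wnorm_add[of "r x" "sum r F"] by simp
qed auto

text \<open>The dilation divides the i-th coefficient by \<open>k ^ i\<close>, and divisibility
  leaves only coefficients with \<open>i \<ge> n\<close>.\<close>

lemma wnorm_dilation_le:
  fixes W :: "'k::real_normed_field poly"
  assumes W: "[:0, 1:] ^ n dvd W" and k: "k > 0"
  shows "wnorm \<beta> (pcompose W [:0, inverse (of_nat k):]) \<le> wnorm \<beta> W / real k ^ n"
proof -
  have "wnorm \<beta> (pcompose W [:0, inverse (of_nat k):])
      = (\<Sum>i\<le>degree W. norm (coeff W i) / real k ^ i * \<beta> i)"
    by (subst wnorm_altdef[of _ "degree W"])
      (auto simp: coeff_pcompose_dilation norm_mult norm_power norm_inverse norm_divide field_simps
        intro: order.trans[OF degree_pcompose_le])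
  also have "\<dots> \<le> (\<Sum>i\<le>degree W. norm (coeff W i) / real k ^ n * \<beta> i)"
  proof (intro sum_mono mult_right_mono \<beta>)
    fix i
    show "norm (coeff W i) / real k ^ i \<le> norm (coeff W i) / real k ^ n"
    proof (cases "i < n")
      case True
      have "[:0, 1:] ^ n = monom (1::'k) n" by (simp add: monom_altdef)
      then have "coeff W i = 0" using W True by (auto simp: coeff_monom_mult elim!: dvdE)
      then show ?thesis by simp
    next
      case False
      then show ?thesis using k
        by (intro divide_left_mono power_increasing) auto
    qed
  qed
  also have "\<dots> = wnorm \<beta> W / real k ^ n"
    by (simp add: wnorm_def sum_divide_distrib)
  finally show ?thesis .
qed

text \<open>The translate of \<open>q\<close> grows at most like \<open>k ^ degree q\<close>,
  whereas the dilate of \<open>W\<close> decays like \<open>k ^ n\<close> in the denominator. As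
  \<open>degree q < n\<close>, a factor \<open>1 / k\<close> remains.\<close>

lemma wnorm_translate_dilate_tendsto_0:
  fixes q W :: "'k::real_normed_field poly"
  assumes W: "[:0, 1:] ^ n dvd W" and q: "degree q < n"
  shows "(\<lambda>k. wnorm \<beta> (pcompose q [:c * of_nat k, 1:] * pcompose W [:0, inverse (of_nat k):]))
           \<longlonglongrightarrow> 0"
proof (rule real_tendsto_sandwich[OF _ _ tendsto_const])
  define B where "B k = (\<Sum>i\<le>degree q. norm (coeff q i) * wnorm \<beta> ([:c, 1:] ^ i * W)) / real k" for k
  show "\<forall>\<^sub>F k in sequentially.
      0 \<le> wnorm \<beta> (pcompose q [:c * of_nat k, 1:] * pcompose W [:0, inverse (of_nat k):])"
    by (intro always_eventually allI wnorm_nonneg)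
  show "B \<longlonglongrightarrow> 0"
    unfolding B_def by (rule lim_const_over_n)
  show "\<forall>\<^sub>F k in sequentially.
      wnorm \<beta> (pcompose q [:c * of_nat k, 1:] * pcompose W [:0, inverse (of_nat k):]) \<le> B k"
    using eventually_gt_at_top[of 0]
  proof eventually_elim
    case (elim k)
    \<comment> \<open>Since \<open>z + c * k = k * (z / k + c)\<close>, the powers of the translated
      variable are dilates up to powers of \<open>k\<close> and can be merged with the dilate of
      \<open>W\<close>.\<close>
    have lin: "[:c * of_nat k, 1:] = smult (of_nat k) (pcompose [:c, 1:] [:0, inverse (of_nat k):])"
      using elim by (simp add: pcompose_pCons)
    have "pcompose q [:c * of_nat k, 1:] =
        (\<Sum>i\<le>degree q. smult (coeff q i) ([:c * of_nat k, 1:] ^ i))"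
      by (subst (1) poly_as_sum_of_monoms[of q, symmetric])
        (simp add: pcompose_sum monom_altdef pcompose_smult pcompose_power
          pcompose_pCons)
    also have "\<dots> * pcompose W [:0, inverse (of_nat k):] =
        (\<Sum>i\<le>degree q. smult (coeff q i * of_nat k ^ i)
          (pcompose ([:c, 1:] ^ i * W) [:0, inverse (of_nat k):]))"
      by (simp only: lin smult_power pcompose_mult pcompose_power sum_distrib_right)
        (simp add: smult_power)
    also have "wnorm \<beta> \<dots> \<le> (\<Sum>i\<le>degree q. wnorm \<beta> (smult (coeff q i * of_nat k ^ i)
          (pcompose ([:c, 1:] ^ i * W) [:0, inverse (of_nat k):])))"
      by (rule wnorm_sum)
    also have "\<dots> \<le> (\<Sum>i\<le>degree q. norm (coeff q i) * wnorm \<beta> ([:c, 1:] ^ i * W) / real k)"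
    proof (rule sum_mono)
      fix i assume i: "i \<in> {..degree q}"
      have "wnorm \<beta> (smult (coeff q i * of_nat k ^ i)
              (pcompose ([:c, 1:] ^ i * W) [:0, inverse (of_nat k):]))
          \<le> norm (coeff q i) * real k ^ i * (wnorm \<beta> ([:c, 1:] ^ i * W) / real k ^ n)"
        unfolding wnorm_smult norm_mult norm_power norm_of_nat
        by (intro mult_left_mono wnorm_dilation_le dvd_mult W elim) simp
      also have "\<dots> = norm (coeff q i) * wnorm \<beta> ([:c, 1:] ^ i * W) * (real k ^ i / real k ^ n)"
        by simp
      also have "\<dots> \<le> norm (coeff q i) * wnorm \<beta> ([:c, 1:] ^ i * W) * (1 / real k)"
      proof (rule mult_left_mono)
        have "real k ^ Suc i \<le> real k ^ n"
          using i q elim by (intro power_increasing) auto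
        then show "real k ^ i / real k ^ n \<le> 1 / real k"
          using elim by (simp add: field_simps)
      qed (intro mult_nonneg_nonneg norm_ge_zero wnorm_nonneg)
      finally show "wnorm \<beta> (smult (coeff q i * of_nat k ^ i)
              (pcompose ([:c, 1:] ^ i * W) [:0, inverse (of_nat k):]))
          \<le> norm (coeff q i) * wnorm \<beta> ([:c, 1:] ^ i * W) / real k" by simp
    qed
    also have "\<dots> = B k" by (simp add: B_def sum_divide_distrib)
    finally show ?case .
  qed
qed

text \<open>The dilate of \<open>W\<close> vanishes to order \<open>n\<close> at 0 and equals 1 to
  order \<open>n\<close> at \<open>k\<close>. Multiplying \<open>q(z - k) - p(z)\<close> by it gives
  a correction \<open>h\<close> that is small at 0, and \<open>p + h\<close> agrees with
  \<open>q(z - k)\<close> near \<open>k\<close> up to an error of the same type after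
  translation.\<close>

lemma translation_mixing:
  fixes p q :: "'k::real_normed_field poly"
  assumes \<epsilon>: "\<epsilon> > 0"
  shows "\<forall>\<^sub>F k in sequentially. \<exists>h. wnorm \<beta> h \<le> \<epsilon> \<and>
           wnorm \<beta> (pcompose (p + h) [:of_nat k, 1:] - q) \<le> \<epsilon>"
proof -
  define n where "n = Suc (max (degree p) (degree q))"
  obtain u v :: "'k poly" where uv: "u * [:0, 1:] ^ n + v * [:1, -1:] ^ n = 1"
    using bezout_power[of "[:0, 1::'k:]" "[:1, -1:]" n] by (auto simp: one_pCons)
  define W where "W = u * [:0, 1:] ^ n"
  \<comment> \<open>This is \<open>1 - W\<close> shifted by 1, which turns \<open>1 - z\<close> into
    \<open>- z\<close> and hence gives divisibility by the n-th power of \<open>z\<close>.\<close>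
  define W' where "W' = pcompose (v * [:1, -1:] ^ n) [:1, 1:]"
  have dvd: "[:0, 1:] ^ n dvd W" "[:0, 1:] ^ n dvd W'"
  proof -
    have "pcompose [:1, -1:] [:1, 1:] = - [:0, 1::'k:]"
      by (simp add: pcompose_pCons)
    then have "W' = pcompose v [:1, 1:] * (- [:0, 1:]) ^ n"
      by (simp add: W'_def pcompose_mult pcompose_power)
    then show "[:0, 1:] ^ n dvd W'"
      by (subst (asm) power_minus) simp
  qed (simp add: W_def)
  define dil where "dil k r = pcompose r [:0, inverse (of_nat k):]" for k and r :: "'k poly"
  define R where "R k = pcompose q [:- of_nat k, 1:] - p" for k
  define h where "h k = R k * dil k W" for k
  define e where "e k = (pcompose p [:of_nat k, 1:] - q) * dil k W'" for k
  \<comment> \<open>The case \<open>c = 0\<close> covers the untranslated polynomials.\<close>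
  have lim: "(\<lambda>k. wnorm \<beta> (pcompose r [:c * of_nat k, 1:] * dil k V)) \<longlonglongrightarrow> 0"
    if "r \<in> {p, q}" "V \<in> {W, W'}" for r V c
    unfolding dil_def
    by (rule wnorm_translate_dilate_tendsto_0[of n]) (use that dvd in \<open>auto simp: n_def\<close>)
  have small: "(\<lambda>k. wnorm \<beta> (a k - b k)) \<longlonglongrightarrow> 0"
    if "(\<lambda>k. wnorm \<beta> (a k)) \<longlonglongrightarrow> 0" "(\<lambda>k. wnorm \<beta> (b k)) \<longlonglongrightarrow> 0" for a b :: "nat \<Rightarrow> 'k poly"
  proof (rule real_tendsto_sandwich[OF _ _ tendsto_const])
    show "\<forall>\<^sub>F k in sequentially. 0 \<le> wnorm \<beta> (a k - b k)"
      by (intro always_eventually allI wnorm_nonneg)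
    show "\<forall>\<^sub>F k in sequentially. wnorm \<beta> (a k - b k) \<le> wnorm \<beta> (a k) + wnorm \<beta> (b k)"
      using wnorm_add[of "a _" "- b _"] by (intro always_eventually allI) simp
    show "(\<lambda>k. wnorm \<beta> (a k) + wnorm \<beta> (b k)) \<longlonglongrightarrow> 0"
      using tendsto_add[OF that] by simp
  qed
  have "(\<lambda>k. wnorm \<beta> (h k)) \<longlonglongrightarrow> 0"
    using small[OF lim[of q W "-1"] lim[of p W 0]]
    by (simp add: h_def R_def left_diff_distrib)
  moreover have "(\<lambda>k. wnorm \<beta> (e k)) \<longlonglongrightarrow> 0"
    using small[OF lim[of p W' 1] lim[of q W' 0]]
    by (simp add: e_def left_diff_distrib)
  ultimately have "\<forall>\<^sub>F k in sequentially. wnorm \<beta> (h k) < \<epsilon> \<and> wnorm \<beta> (e k) < \<epsilon> \<and> k > 0"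
    using \<epsilon> by (intro eventually_conj order_tendstoD(2) eventually_gt_at_top)
  then show ?thesis
  proof eventually_elim
    case (elim k)
    have "dil k W + dil k (v * [:1, -1:] ^ n) = 1"
      unfolding dil_def W_def using uv by (simp add: pcompose_1 flip: pcompose_add)
    then have W: "dil k W = 1 - dil k (v * [:1, -1:] ^ n)" by (simp add: algebra_simps)
    have "p + h k - pcompose q [:- of_nat k, 1:] = - R k * dil k (v * [:1, -1:] ^ n)"
      unfolding h_def R_def W by (simp add: algebra_simps)
    then have "pcompose (p + h k - pcompose q [:- of_nat k, 1:]) [:of_nat k, 1:] =
        - pcompose (R k) [:of_nat k, 1:] * pcompose (dil k (v * [:1, -1:] ^ n)) [:of_nat k, 1:]"
      by (simp add: pcompose_mult pcompose_uminus)
    also have "pcompose (R k) [:of_nat k, 1:] = q - pcompose p [:of_nat k, 1:]"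
      by (simp add: R_def pcompose_diff pcompose_assoc [symmetric] pcompose_pCons)
    also have "pcompose (dil k (v * [:1, -1:] ^ n)) [:of_nat k, 1:] = dil k W'"
      using elim unfolding dil_def W'_def by (simp add: pcompose_assoc [symmetric] pcompose_pCons)
    finally have "pcompose (p + h k) [:of_nat k, 1:] - q = e k"
      by (simp add: e_def pcompose_diff pcompose_assoc [symmetric] pcompose_pCons)
    then show ?case using elim by (auto intro!: exI[of _ "h k"])
  qed
qed

end

section \<open>Hypercyclic vectors from the polynomial model\<close>

text \<open>A single countable set serves all weights: coefficients are approximated one by one
  within a tolerance that depends on the total weight up to the degree, and the degree is not
  increased.\<close>

lemma countable_dense_polys:
  obtains Q :: "'k::{real_normed_field,second_countable_topology} poly set"
  where "countable Q" "Q \<noteq> {}"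
    "\<And>(\<beta> :: nat \<Rightarrow> real) r \<epsilon>. (\<And>i. 0 \<le> \<beta> i) \<Longrightarrow> 0 < \<epsilon> \<Longrightarrow> \<exists>q\<in>Q. wnorm \<beta> (r - q) \<le> \<epsilon>"
proof -
  obtain D :: "'k set" where D: "countable D" "\<And>X. open X \<Longrightarrow> X \<noteq> {} \<Longrightarrow> \<exists>d\<in>D. d \<in> X"
    using countable_dense_setE by blast
  show thesis
  proof (rule that[of "Poly ` lists D"])
    show "countable (Poly ` lists D)" using D(1) by auto
    show "Poly ` lists D \<noteq> {}" by auto
    fix \<beta> :: "nat \<Rightarrow> real" and r :: "'k poly" and \<epsilon> :: real
    assume \<beta>: "\<And>i. 0 \<le> \<beta> i" and \<epsilon>: "0 < \<epsilon>"
    define B where "B = (\<Sum>i\<le>degree r. \<beta> i)"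
    define \<delta> where "\<delta> = \<epsilon> / (B + 1)"
    have B: "0 \<le> B" unfolding B_def by (intro sum_nonneg \<beta>)
    then have \<delta>: "0 < \<delta>" using \<epsilon> by (simp add: \<delta>_def)
    have "\<exists>d\<in>D. d \<in> ball (coeff r i) \<delta>" for i using \<delta> by (intro D(2)) auto
    then obtain d where d: "\<And>i. d i \<in> D" "\<And>i. dist (coeff r i) (d i) < \<delta>"
      by (metis mem_ball)
    define q where "q = Poly (map d [0..<Suc (degree r)])"
    have coeff_q: "coeff q i = (if i \<le> degree r then d i else 0)" for i
      by (auto simp: q_def nth_default_def simp del: upt_Suc)
    have "degree (r - q) \<le> degree r"
      by (rule degree_le) (auto simp: coeff_q coeff_eq_0)
    then have "wnorm \<beta> (r - q) = (\<Sum>i\<le>degree r. norm (coeff r i - d i) * \<beta> i)"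
      by (simp add: wnorm_altdef coeff_q)
    also have "\<dots> \<le> (\<Sum>i\<le>degree r. \<delta> * \<beta> i)"
      using d(2) by (intro sum_mono mult_right_mono \<beta>) (simp add: dist_norm less_imp_le)
    also have "\<dots> = \<delta> * B" by (simp add: B_def sum_distrib_left)
    also have "\<dots> \<le> \<epsilon>" using B \<epsilon> by (simp add: \<delta>_def field_simps)
    finally have "wnorm \<beta> (r - q) \<le> \<epsilon>" .
    moreover have "q \<in> Poly ` lists D" unfolding q_def using d(1) by (intro imageI) auto
    ultimately show "\<exists>q\<in>Poly ` lists D. wnorm \<beta> (r - q) \<le> \<epsilon>" by blast
  qed
qed

text \<open>The linear map from polynomials to vectors that sends the i-th monomial to
  \<open>w i\<close>.\<close>

definition poly_comb :: "('k::field \<Rightarrow> 'a::ab_group_add \<Rightarrow> 'a) \<Rightarrow> (nat \<Rightarrow> 'a) \<Rightarrow> 'k poly \<Rightarrow> 'a" where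
  "poly_comb smul w r = (\<Sum>i\<le>degree r. smul (coeff r i) (w i))"

section \<open>The linear map from polynomials to vectors\<close>

context vector_space
begin

lemma poly_comb_altdef:
  assumes "degree r \<le> n"
  shows "poly_comb scale w r = (\<Sum>i\<le>n. scale (coeff r i) (w i))"
  unfolding poly_comb_def
  by (rule sum.mono_neutral_left) (use assms in \<open>auto simp: not_le coeff_eq_0\<close>)

lemma poly_comb_add: "poly_comb scale w (r + s) = poly_comb scale w r + poly_comb scale w s"
proof -
  let ?n = "max (degree r) (degree s)"
  show ?thesis
    by (simp add: poly_comb_altdef[OF degree_add_le_max] poly_comb_altdef[of _ ?n]
        scale_left_distrib sum.distrib)
qed

lemma poly_comb_smult: "poly_comb scale w (smult c r) = scale c (poly_comb scale w r)"
  by (simp add: poly_comb_altdef[of _ "degree r"] scale_sum_right)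

lemma poly_comb_minus: "poly_comb scale w (r - s) = poly_comb scale w r - poly_comb scale w s"
  using poly_comb_add[of w "r - s" s] by simp

lemma poly_comb_sum: "poly_comb scale w (\<Sum>i\<in>I. r i) = (\<Sum>i\<in>I. poly_comb scale w (r i))"
  by (induction I rule: infinite_finite_induct) (simp_all add: poly_comb_add, simp_all add: poly_comb_def)

lemma poly_comb_monom: "poly_comb scale w (monom c n) = scale c (w n)"
proof -
  have "poly_comb scale w (monom c n) = (\<Sum>i\<le>n. if i = n then scale c (w n) else 0)"
    unfolding poly_comb_altdef[OF degree_monom_le] by (rule sum.cong) auto
  then show ?thesis by simp
qed

lemma span_subset_range_poly_comb: "span (range w) \<subseteq> range (poly_comb scale w)"
proof
  fix z assume "z \<in> span (range w)"
  then show "z \<in> range (poly_comb scale w)"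
  proof (induction rule: span_induct_alt)
    case base
    show ?case by (rule range_eqI[of _ _ 0]) (simp add: poly_comb_def)
  next
    case (step c y z)
    then obtain n r where "y = w n" "z = poly_comb scale w r" by blast
    then have "scale c y + z = poly_comb scale w (monom c n + r)"
      by (simp add: poly_comb_add poly_comb_monom)
    then show ?case by blast
  qed
qed

end

locale separable_l1_disc = l1_disc smul x
  for smul :: "'k::{real_normed_field,banach,second_countable_topology} \<Rightarrow>
      'a::{topological_ab_group_add,t2_space} \<Rightarrow> 'a" and x
begin

lemma in_disc_poly_comb:
  assumes "\<And>n. in_disc (w n) (\<beta> n)"
  shows "in_disc (poly_comb smul w r) (wnorm \<beta> r)"
  unfolding poly_comb_def wnorm_def by (intro in_disc_sum in_disc_scale assms)

text \<open>The hypercyclic vector is the limit of a sequence of polynomials; each correction is so small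
  that the iterates already used stay close to their targets.\<close>
lemma hereditarily_hypercyclicI:
  assumes lin: "Vector_Spaces.linear smul smul T"
    and K: "1 \<le> K" "\<And>z s. in_disc z s \<Longrightarrow> in_disc (T z) (K * s)"
    and w: "\<And>n. in_disc (w n) (\<beta> n)"
    and dense: "closure (span (range w)) = UNIV"
    and Tw: "\<And>n. T (w n) = (\<Sum>j\<le>n. smul (of_nat (n choose j)) (w j))"
  shows "hereditarily_hypercyclic T"
proof -
  interpret T: Vector_Spaces.linear smul smul T by (fact lin)
  have \<beta>: "0 \<le> \<beta> n" for n using in_disc_nonneg[OF w] .
  define \<Phi> where "\<Phi> = poly_comb smul w"
  note \<Phi>_minus = poly_comb_minus[of w, folded \<Phi>_def]
  have disc: "in_disc (\<Phi> r) \<epsilon>" if "wnorm \<beta> r \<le> \<epsilon>" for r \<epsilon>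
    using in_disc_mono[OF in_disc_poly_comb[OF w] that] by (simp add: \<Phi>_def)
  \<comment> \<open>By the binomial theorem \<open>Tw\<close> says that monomials are translated by
    1, and linearity extends this to all polynomials.\<close>
  have T\<Phi>: "T (\<Phi> r) = \<Phi> (pcompose r [:1, 1:])" for r
  proof -
    have mono: "T (\<Phi> (monom 1 n)) = \<Phi> (pcompose (monom 1 n) [:1, 1:])" for n
    proof -
      have "degree ([:1, 1::'k:] ^ n) \<le> n"
        using degree_power_le[of "[:1, 1::'k:]" n] by simp
      then have "\<Phi> ([:1, 1:] ^ n) = (\<Sum>j\<le>n. smul (of_nat (n choose j)) (w j))"
        by (simp add: \<Phi>_def poly_comb_altdef coeff_linear_poly_power)
      moreover have "pcompose (monom 1 n) [:1, 1::'k:] = [:1, 1:] ^ n"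
        by (simp add: monom_altdef pcompose_smult pcompose_power pcompose_pCons)
      ultimately show ?thesis
        using Tw[of n] by (simp add: \<Phi>_def poly_comb_monom)
    qed
    have r: "r = (\<Sum>i\<le>degree r. smult (coeff r i) (monom 1 i))"
      by (simp add: smult_monom poly_as_sum_of_monoms)
    show ?thesis
      by (subst (1 2) r) (simp only: \<Phi>_def poly_comb_sum poly_comb_smult pcompose_sum
          pcompose_smult T.sum T.scale mono[unfolded \<Phi>_def])
  qed
  have Tn\<Phi>: "(T ^^ n) (\<Phi> r) = \<Phi> (pcompose r [:of_nat n, 1:])" for n r
    by (induction n) (simp_all add: T\<Phi> pcompose_pCons add.commute flip: pcompose_assoc)
  have Tn_add: "(T ^^ n) (y + z) = (T ^^ n) y + (T ^^ n) z" for n y z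
    by (induction n) (simp_all add: T.add)
  have Tn_disc: "in_disc ((T ^^ n) z) (K ^ n * s)" if "in_disc z s" for n z s
    by (induction n) (use that K(2) in \<open>auto simp: mult.assoc\<close>)
  obtain Q :: "'k poly set" where Q: "countable Q" "Q \<noteq> {}"
    "\<And>r \<epsilon>. 0 < \<epsilon> \<Longrightarrow> \<exists>q\<in>Q. wnorm \<beta> (r - q) \<le> \<epsilon>"
    using countable_dense_polys \<beta> by metis
  \<comment> \<open>Every element of \<open>Q\<close> is a target at infinitely many stages, one for
    each second component of the decoded pair.\<close>
  define e where "e k = from_nat_into Q (fst (prod_decode k))" for k
  show ?thesis
    unfolding hereditarily_hypercyclic_def
  proof (intro allI impI)
    fix A :: "nat set" assume A: "infinite A"
    \<comment> \<open>Mixing holds for all large \<open>k\<close>, so any infinite set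
      \<open>A\<close> contains a suitable exponent; this makes the hypercyclicity
      hereditary.\<close>
    have next_step: "\<exists>P' n'. n' \<in> A \<and> n \<le> n' \<and> in_disc (\<Phi> P' - \<Phi> P) \<epsilon> \<and>
        in_disc ((T ^^ n') (\<Phi> P') - \<Phi> q) \<delta>" if "0 < \<epsilon>" "0 < \<delta>" for P q n \<epsilon> \<delta>
    proof -
      have "\<forall>\<^sub>F k in sequentially. \<exists>h. wnorm \<beta> h \<le> min \<epsilon> \<delta> \<and>
           wnorm \<beta> (pcompose (P + h) [:of_nat k, 1:] - q) \<le> min \<epsilon> \<delta>"
        using that by (intro translation_mixing \<beta>) auto
      then obtain N where N: "\<And>k. N \<le> k \<Longrightarrow> \<exists>h. wnorm \<beta> h \<le> min \<epsilon> \<delta> \<and>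
           wnorm \<beta> (pcompose (P + h) [:of_nat k, 1:] - q) \<le> min \<epsilon> \<delta>"
        by (auto simp: eventually_sequentially)
      obtain k where k: "k \<in> A" "max N n \<le> k"
        using A unfolding infinite_nat_iff_unbounded_le by blast
      then obtain h where h: "wnorm \<beta> h \<le> \<epsilon>" "wnorm \<beta> (pcompose (P + h) [:of_nat k, 1:] - q) \<le> \<delta>"
        using N[of k] by auto
      have "\<Phi> (P + h) - \<Phi> P = \<Phi> h" by (simp flip: \<Phi>_minus)
      with disc[OF h(1)] disc[OF h(2)] k show ?thesis
        by (intro exI[of _ "P + h"] exI[of _ k]) (simp add: Tn\<Phi> \<Phi>_minus)
    qed
    define good where "good k s \<longleftrightarrow> snd s \<in> A \<and>
        in_disc ((T ^^ snd s) (\<Phi> (fst s)) - \<Phi> (e k)) ((1/2) ^ k)" for k :: nat and s :: "'k poly \<times> nat"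
    \<comment> \<open>The iterate already used enlarges disc bounds by at most
      \<open>K ^ snd s\<close>, hence the inverse factor. As the exponents never decrease, later
      corrections are small for all earlier iterates too.\<close>
    define step where "step k s s' \<longleftrightarrow> snd s \<le> snd s' \<and>
        in_disc (\<Phi> (fst s') - \<Phi> (fst s)) ((1/2) ^ k * inverse (K ^ snd s))"
      for k :: nat and s s' :: "'k poly \<times> nat"
    have "\<exists>s. \<forall>k. good k (s k) \<and> step k (s k) (s (Suc k))"
    proof (rule dependent_nat_choice)
      show "\<exists>s. good 0 s" using next_step[of 1 1 0 0 "e 0"] by (auto simp: good_def)
      show "\<exists>s'. good (Suc k) s' \<and> step k s s'" for s k
        using next_step[of "(1/2) ^ k * inverse (K ^ snd s)" "(1/2) ^ Suc k" "snd s" "fst s" "e (Suc k)"] K(1)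
        by (auto simp: good_def step_def)
    qed
    then obtain s where s: "\<And>k. good k (s k)" "\<And>k. step k (s k) (s (Suc k))" by blast
    define P n where "P k = fst (s k)" and "n k = snd (s k)" for k
    have nA: "n k \<in> A" and approx: "in_disc ((T ^^ n k) (\<Phi> (P k)) - \<Phi> (e k)) ((1/2) ^ k)" for k
      using s(1)[of k] by (auto simp: good_def P_def n_def)
    define u g where "u k = \<Phi> (P (Suc k)) - \<Phi> (P k)" and "g k = (1/2) ^ k * inverse (K ^ n k)" for k
    have u: "in_disc (u k) (g k)" and n_Suc: "n k \<le> n (Suc k)" for k
      using s(2)[of k] by (auto simp: step_def P_def n_def u_def g_def)
    have mono: "n i \<le> n j" if "i \<le> j" for i j using n_Suc that by (rule lift_Suc_mono_le)
    have geo: "(\<lambda>k. (1/2) ^ (k + N)) sums (2 * (1/2::real) ^ N)" for N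
      using sums_mult2[OF geometric_sums[of "1/2::real"], of "(1/2) ^ N"] by (simp add: power_add)
    have g_le: "g (k + N) \<le> (1/2) ^ (k + N) * inverse (K ^ n N)" for k N
      unfolding g_def using K(1) mono[of N "k + N"]
      by (intro mult_left_mono le_imp_inverse_le power_increasing) auto
    have g_nonneg: "0 \<le> g k" for k using K(1) by (simp add: g_def)
    have g: "summable (\<lambda>k. g (k + N))" "(\<Sum>k. g (k + N)) \<le> 2 * (1/2) ^ N * inverse (K ^ n N)" for N
    proof -
      note sm = sums_mult2[OF geo[of N], of "inverse (K ^ n N)"]
      show *: "summable (\<lambda>k. g (k + N))"
        by (rule summable_comparison_test'[OF sums_summable[OF sm], of 0]) (simp add: g_le g_nonneg)
      show "(\<Sum>k. g (k + N)) \<le> 2 * (1/2) ^ N * inverse (K ^ n N)"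
        using suminf_le[OF g_le * sums_summable[OF sm]] by (simp add: sums_unique[OF sm, symmetric])
    qed
    obtain z where z: "\<And>N. in_disc (z - (\<Sum>k<N. u k)) (\<Sum>k. g (k + N))"
      using in_disc_series[of u g, OF u] g(1)[of 0] by auto
    define v where "v = \<Phi> (P 0) + z"
    \<comment> \<open>One \<open>(1/2) ^ N\<close> comes from stage \<open>N\<close> itself and two
      from the geometric tail of the later corrections.\<close>
    have orbit: "in_disc ((T ^^ n N) v - \<Phi> (e N)) (3 * (1/2) ^ N)" for N
    proof -
      have "(\<Sum>k<N. u k) = \<Phi> (P N) - \<Phi> (P 0)" unfolding u_def by (rule sum_lessThan_telescope)
      then have v: "v = \<Phi> (P N) + (z - (\<Sum>k<N. u k))" by (simp add: v_def)
      have "(T ^^ n N) v - \<Phi> (e N) =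
          ((T ^^ n N) (\<Phi> (P N)) - \<Phi> (e N)) + (T ^^ n N) (z - (\<Sum>k<N. u k))"
        by (subst v) (simp only: Tn_add, simp only: algebra_simps)
      moreover have "in_disc (((T ^^ n N) (\<Phi> (P N)) - \<Phi> (e N)) + (T ^^ n N) (z - (\<Sum>k<N. u k)))
          ((1/2) ^ N + K ^ n N * (\<Sum>k. g (k + N)))"
        by (intro in_disc_add approx Tn_disc z)
      moreover have "K ^ n N * (\<Sum>k. g (k + N)) \<le> K ^ n N * (2 * (1/2) ^ N * inverse (K ^ n N))"
        using K(1) g(2) by (intro mult_left_mono) auto
      then have "(1/2) ^ N + K ^ n N * (\<Sum>k. g (k + N)) \<le> 3 * (1/2) ^ N" using K(1) by (simp add: field_simps)
      ultimately show ?thesis by (simp only:) (rule in_disc_mono)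
    qed
    have "y \<in> closure {(T ^^ n) v | n. n \<in> A}" for y
      unfolding closure_csn_iff
    proof (intro allI impI)
      fix q and \<epsilon> :: real assume q: "continuous_seminorm q" and \<epsilon>: "0 < \<epsilon>"
      obtain M where M: "0 < M" "\<And>z t. in_disc z t \<Longrightarrow> q z \<le> M * t" using csn_in_disc[OF q] by blast
      have "y \<in> closure (span (range w))" using dense by simp
      then obtain r where r: "q (\<Phi> r - y) < \<epsilon> / 3"
        unfolding closure_csn_iff using q \<epsilon> span_subset_range_poly_comb[of w]
        by (fastforce simp: \<Phi>_def dest!: spec[of _ q] spec[of _ "\<epsilon> / 3"])
      obtain r' where r': "r' \<in> Q" "wnorm \<beta> (r - r') \<le> \<epsilon> / (3 * M)"
        using Q(3)[of "\<epsilon> / (3 * M)" r] \<epsilon> M(1) by auto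
      obtain i where i: "from_nat_into Q i = r'"
        using r'(1) range_from_nat_into[OF Q(2,1)] by (metis imageE)
      have "(\<lambda>N. M * (3 * (1/2) ^ N)) \<longlonglongrightarrow> 0"
        by (intro tendsto_mult_right_zero LIMSEQ_realpow_zero) auto
      then have "\<forall>\<^sub>F N in sequentially. M * (3 * (1/2) ^ N) < \<epsilon> / 3"
        using \<epsilon> by (intro order_tendstoD) auto
      then obtain N0 where N0: "\<And>N. N0 \<le> N \<Longrightarrow> M * (3 * (1/2) ^ N) < \<epsilon> / 3"
        by (auto simp: eventually_sequentially)
      \<comment> \<open>A stage whose target is \<open>r'\<close> and which is late enough for the
        orbit error to be below \<open>\<epsilon> / 3\<close>.\<close>
      define N where "N = prod_encode (i, N0)"
      have eN: "e N = r'" by (simp add: e_def N_def i)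
      have "q ((T ^^ n N) v - \<Phi> r') < \<epsilon> / 3"
        using M(2)[OF orbit[of N]] N0[of N] le_prod_encode_2[of N0 i]
        unfolding eN by (fold N_def) linarith
      moreover have "q (\<Phi> r' - \<Phi> r) \<le> \<epsilon> / 3"
      proof -
        have "q (\<Phi> (r - r')) \<le> M * (\<epsilon> / (3 * M))" by (intro M(2) disc r')
        then show ?thesis using M(1) csnD(7)[OF q, of "\<Phi> r'" "\<Phi> r"] by (simp add: \<Phi>_minus)
      qed
      moreover have "q ((T ^^ n N) v - y) \<le> q ((T ^^ n N) v - \<Phi> r') + (q (\<Phi> r' - \<Phi> r) + q (\<Phi> r - y))"
        using csnD(1)[OF q, of "(T ^^ n N) v - \<Phi> r'" "(\<Phi> r' - \<Phi> r) + (\<Phi> r - y)"]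
          csnD(1)[OF q, of "\<Phi> r' - \<Phi> r" "\<Phi> r - y"] by (simp add: algebra_simps)
      ultimately have "q ((T ^^ n N) v - y) < \<epsilon>" using r by linarith
      then show "\<exists>y'\<in>{(T ^^ n) v | n. n \<in> A}. q (y' - y) < \<epsilon>" using nA by blast
    qed
    then show "\<exists>v. closure {(T ^^ n) v | n. n \<in> A} = UNIV" by blast
  qed
qed

end

section \<open>The operator\<close>

theorem (in separable_l1_disc) exists_hereditarily_hypercyclic:
  assumes nw: "\<not> has_weak_topology smul" and norming: "norming_functionals smul"
    and dense: "closure (span (range x)) = UNIV"
  shows "\<exists>T\<in>continuous_linear_operators smul. hereditarily_hypercyclic T"
proof -
  obtain p w f t where p: "continuous_seminorm p"
    and f: "\<And>n. Vector_Spaces.linear smul (*) (f n)"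
    and ft: "\<And>n v. norm (f n v) * t n \<le> (1/2) ^ n * p v"
    and fw: "\<And>i j. f i (w j) = (if i = j then 1 else 0)"
    and t: "\<And>n. in_disc (\<Sum>j<n. smul (of_nat (n choose j)) (w j)) (t n)"
    and w: "\<And>n. w n \<in> span (range x)" "closure (span (range w)) = UNIV"
    by (rule biorthogonal_system[OF nw norming dense]; blast)
  define u where "u n = (\<Sum>j<n. smul (of_nat (n choose j)) (w j))" for n
  \<comment> \<open>A series of rank-one operators. By \<open>ft\<close> its terms are dominated in
    the disc norm by a geometric series, with total \<open>2 * p v\<close>.\<close>
  define L where "L v = (\<Sum>n. smul (f n v) (u n))" for v
  have L: "(\<lambda>n. smul (f n v) (u n)) sums L v" "in_disc (L v) (2 * p v)" for v
  proof -
    have geo: "(\<lambda>n. (1/2) ^ n * p v) sums (2 * p v)"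
      using sums_mult2[OF geometric_sums[of "1/2::real"], of "p v"] by simp
    have disc: "in_disc (smul (f n v) (u n)) ((1/2) ^ n * p v)" for n
      using in_disc_mono[OF in_disc_scale[OF t] ft] by (simp add: u_def)
    have "(\<lambda>n. smul (f n v) (u n)) sums L v \<and> in_disc (L v) (2 * p v)"
    proof (rule in_disc_series[OF disc sums_summable[OF geo]])
      fix z assume z: "(\<lambda>n. smul (f n v) (u n)) sums z" "in_disc z (\<Sum>n. (1/2) ^ n * p v)"
      from z(1) have "L v = z" by (simp add: L_def sums_iff)
      with z show ?thesis unfolding sums_unique[OF geo] by simp
    qed
    then show "(\<lambda>n. smul (f n v) (u n)) sums L v" "in_disc (L v) (2 * p v)" by simp_all
  qed
  have f_add: "f n (a + b) = f n a + f n b" and f_scale: "f n (smul c a) = c * f n a" for n a b c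
    using f[of n] unfolding Vector_Spaces.linear_iff by blast+
  have L_add: "L (a + b) = L a + L b" for a b
    using sums_unique2[OF L(1)[of "a + b"]] sums_add[OF L(1)[of a] L(1)[of b]]
    by (simp add: f_add scale_left_distrib)
  have L_scale: "L (smul c a) = smul c (L a)" for c a
  proof (rule sums_unique2[OF L(1)[of "smul c a"]])
    have "(\<lambda>N. smul c (\<Sum>n<N. smul (f n a) (u n))) \<longlonglongrightarrow> smul c (L a)"
      using L(1)[of a] unfolding sums_def by (intro tendsto_scale tendsto_const)
    then show "(\<lambda>n. smul (f n (smul c a)) (u n)) sums smul c (L a)"
      unfolding sums_def by (simp add: scale_sum_right f_scale)
  qed
  define T where "T v = v + L v" for v
  have lin: "Vector_Spaces.linear smul smul T"
    unfolding Vector_Spaces.linear_iff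
    by (auto simp: T_def L_add L_scale scale_right_distrib intro: vector_space_axioms)
  interpret T: Vector_Spaces.linear smul smul T by (fact lin)
  have "continuous_on UNIV T"
  proof (rule continuous_on_linearI[OF T.diff])
    fix q assume q: "continuous_seminorm q"
    obtain M where M: "0 < M" "\<And>z t. in_disc z t \<Longrightarrow> q z \<le> M * t" using csn_in_disc[OF q] by blast
    \<comment> \<open>A continuous seminorm dominating \<open>q\<close> composed with
      \<open>T\<close>: the disc bound on \<open>L v\<close> contributes
      \<open>M * 2 * p v\<close>.\<close>
    define r where "r v = q v + M * 2 * p v" for v
    have "((\<lambda>v. q v + M * 2 * p v) \<longlongrightarrow> 0 + M * 2 * 0) (nhds 0)"
      using p q unfolding continuous_seminorm_def by (intro tendsto_intros) auto
    moreover have "seminorm_wrt smul r"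
      unfolding seminorm_wrt_def
    proof (intro conjI allI)
      show "r (a + b) \<le> r a + r b" for a b
        using csnD(1)[OF q, of a b] mult_left_mono[OF csnD(1)[OF p, of a b], of "M * 2"] M(1)
        by (simp add: r_def distrib_left)
      show "r (smul c a) = norm c * r a" for c a
        by (simp add: r_def csnD(2)[OF p] csnD(2)[OF q] algebra_simps)
    qed
    ultimately have "continuous_seminorm r" by (simp add: continuous_seminorm_def r_def[abs_def])
    moreover have "q (T v) \<le> 1 * r v" for v
      using csnD(1)[OF q, of v "L v"] M(2)[OF L(2)[of v]] by (simp add: T_def r_def)
    ultimately show "\<exists>p M. continuous_seminorm p \<and> (\<forall>x. q (T x) \<le> M * p x)" by blast
  qed
  then have "T \<in> continuous_linear_operators smul"
    using lin by (simp add: continuous_linear_operators_def)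
  moreover have "hereditarily_hypercyclic T"
  proof -
    obtain M where M: "0 < M" "\<And>z t. in_disc z t \<Longrightarrow> p z \<le> M * t" using csn_in_disc[OF p] by blast
    \<comment> \<open>\<open>p\<close> is itself bounded on the disc, so \<open>T\<close> acts
      boundedly in the disc norm; this gives the constant \<open>K\<close> of the criterion.\<close>
    have T_disc: "in_disc (T z) ((1 + 2 * M) * s)" if "in_disc z s" for z s
    proof -
      have "in_disc (T z) (s + 2 * p z)" unfolding T_def by (intro in_disc_add L(2) that)
      then show ?thesis using M(2)[OF that] by (elim in_disc_mono) (simp add: distrib_right)
    qed
    have Tw: "T (w n) = (\<Sum>j\<le>n. smul (of_nat (n choose j)) (w j))" for n
    proof -
      \<comment> \<open>By biorthogonality only the n-th term survives. The identity part of
        \<open>T\<close> supplies the missing summand \<open>j = n\<close>, whose binomial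
        coefficient is 1.\<close>
      have "(\<lambda>i. smul (f i (w n)) (u i)) = (\<lambda>i. if i = n then u i else 0)"
        by (auto simp: fw)
      then have "L (w n) = u n"
        using sums_unique2[OF L(1)[of "w n"]] sums_single[of n u] by simp
      then show ?thesis by (simp add: T_def u_def lessThan_Suc_atMost[symmetric] add.commute)
    qed
    obtain \<beta> where \<beta>: "\<And>n. in_disc (w n) (\<beta> n)" using in_disc_span[OF w(1)] by metis
    show ?thesis
      by (rule hereditarily_hypercyclicI[OF lin _ T_disc \<beta> w(2) Tw]) (use M(1) in simp)
  qed
  ultimately show ?thesis by blast
qed

section \<open>The real and the complex case\<close>

theorem theorem1p6:
  fixes smulR :: "real \<Rightarrow> 'a::{topological_ab_group_add,t2_space} \<Rightarrow> 'a"
    and smulC :: "complex \<Rightarrow> 'b::{topological_ab_group_add,t2_space} \<Rightarrow> 'b"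
  shows
    "(locally_convex_space smulR \<longrightarrow> \<not> has_weak_topology smulR \<longrightarrow>
      (\<exists>x. l1_sequence smulR x \<and> closure (module.span smulR (range x)) = UNIV) \<longrightarrow>
      (\<exists>T \<in> continuous_linear_operators smulR. hereditarily_hypercyclic T)) \<and>
     (locally_convex_space smulC \<longrightarrow> \<not> has_weak_topology smulC \<longrightarrow>
      (\<exists>x. l1_sequence smulC x \<and> closure (module.span smulC (range x)) = UNIV) \<longrightarrow>
      (\<exists>T \<in> continuous_linear_operators smulC. hereditarily_hypercyclic T))"
proof (intro conjI impI)
  \<comment> \<open>The two cases differ only in the Hahn-Banach lemma that provides the norming
    functionals.\<close>
  assume "locally_convex_space smulR" and nw: "\<not> has_weak_topology smulR"
    and "\<exists>x. l1_sequence smulR x \<and> closure (module.span smulR (range x)) = UNIV"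
  then obtain x where x: "l1_sequence smulR x" "closure (module.span smulR (range x)) = UNIV" by blast
  interpret locally_convex_space smulR by fact
  interpret separable_l1_disc smulR x by unfold_locales (fact x(1))
  show "\<exists>T\<in>continuous_linear_operators smulR. hereditarily_hypercyclic T"
    by (rule exists_hereditarily_hypercyclic[OF nw norming_functionals_real x(2)])
      (fact vector_space_axioms)
next
  assume "locally_convex_space smulC" and nw: "\<not> has_weak_topology smulC"
    and "\<exists>x. l1_sequence smulC x \<and> closure (module.span smulC (range x)) = UNIV"
  then obtain x where x: "l1_sequence smulC x" "closure (module.span smulC (range x)) = UNIV" by blast
  interpret locally_convex_space smulC by fact
  interpret separable_l1_disc smulC x by unfold_locales (fact x(1))
  show "\<exists>T\<in>continuous_linear_operators smulC. hereditarily_hypercyclic T"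
    by (rule exists_hereditarily_hypercyclic[OF nw norming_functionals_complex x(2)])
      (fact vector_space_axioms)
qed

end
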